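(* Let $D=\frac{1}{\imath}\frac{d}{dx}$, $\mathcal{D}=\mathbb{C}[D]$, $q\ge 1$, let $\mathcal{M}\subset\mathcal{D}^q$ be a submodule, and write the torsion submodule as a finite direct sum $(\mathcal{D}^q/\mathcal{M})_{\mathrm{tor}}=\bigoplus_i\mathcal{D}/(D-a_i)^{n_i}$ with $a_i\in\mathbb{C}$, $n_i\ge 1$. Then the Willems closure $\mathcal{M}^{\perp\perp}$ of $\mathcal{M}$ with respect to the signal space $\mathcal{F}$ satisfies $\mathcal{M}^{\perp\perp}/\mathcal{M}\subset(\mathcal{D}^q/\mathcal{M})_{\mathrm{tor}}$ and is given as follows. (1) For $\mathcal{F}=\mathcal{C}^\infty(\mathsf{T})$: $\mathcal{M}^{\perp\perp}/\mathcal{M}=\bigl(\bigoplus_{a_i\notin\mathbb{Z}}\mathcal{D}/(D-a_i)^{n_i}\bigr)\oplus\bigl(\bigoplus_{a_i\in\mathbb{Z}}(D-a_i)\mathcal{D}/(D-a_i)^{n_i}\bigr)$. (2) For $\mathcal{F}=\mathcal{C}^\infty(\mathsf{T})[x]$, or for $\mathcal{F}$ the injective envelope of $\mathcal{C}^\infty(\mathsf{T})$ in it: $\mathcal{M}^{\perp\perp}/\mathcal{M}=\bigoplus_{a_i\notin\mathbb{Z}}\mathcal{D}/(D-a_i)^{n_i}$, and $\mathcal{M}^{\perp\perp}$ consists of the elements $r\in\mathcal{D}^q$ such that $Lr\in\mathcal{M}$ for some $L\in\mathcal{D}$ without zeros in $\mathbb{Z}$. (3) For $\mathcal{F}=\mathcal{C}^\infty(\mathsf{PT})$: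 $\mathcal{M}^{\perp\perp}/\mathcal{M}=\bigl(\bigoplus_{a_i\notin\mathbb{Q}}\mathcal{D}/(D-a_i)^{n_i}\bigr)\oplus\bigl(\bigoplus_{a_i\in\mathbb{Q}}(D-a_i)\mathcal{D}/(D-a_i)^{n_i}\bigr)$. (4) For $\mathcal{F}=\mathcal{C}^\infty(\mathsf{PT})[x]$, or for $\mathcal{F}$ the injective envelope of $\mathcal{C}^\infty(\mathsf{PT})$ in it: $\mathcal{M}^{\perp\perp}/\mathcal{M}=\bigoplus_{a_i\notin\mathbb{Q}}\mathcal{D}/(D-a_i)^{n_i}$, and $\mathcal{M}^{\perp\perp}$ consists of the elements $r\in\mathcal{D}^q$ such that $Lr\in\mathcal{M}$ for some $L\in\mathcal{D}$ without zeros in $\mathbb{Q}$.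
   Context: $\mathcal{C}^\infty(\mathsf{T})$ is the space of smooth functions $\mathbb{R}\to\mathbb{C}$ periodic with respect to $2\pi\mathbb{Z}$, and $\mathcal{C}^\infty(\mathsf{PT})$ is the space of smooth functions $\mathbb{R}\to\mathbb{C}$ periodic with respect to $2\pi N\mathbb{Z}$ for some integer $N\ge 1$ depending on the function. The notation $[x]$ denotes the subalgebra of $\mathcal{C}^\infty(\mathbb{R})$ obtained by adjoining the coordinate function $x$; elements are written uniquely as polynomials $\sum_j f_jx^j$ with periodic coefficients $f_j$. The injective envelope of $\mathcal{C}^\infty(\mathsf{T})$ in $\mathcal{C}^\infty(\mathsf{T})[x]$ (which is unique) consists of the $\sum_j f_jx^j$ such that $f_j$ has finite Fourier expansion for $j\ge 1$; likewise for $\mathsf{PT}$. For a submodule $\mathcal{M}\subset\mathcal{D}^q$, its behavior is $\mathcal{M}^\perp=\{(f_1,\dots,f_q)\in\mathcal{F}^q : \sum_j r_j(f_j)=0 \text{ for all } (r_1,\dots,r_q)\in\mathcal{M}\}$. For a behavior $\mathcal{B}\subset\mathcal{F}^q$, $\mathcal{B}^\perp=\{(r_1,\dots,r_q)\in\mathcal{D}^q : \sum_j r_j(f_j)=0 \text{ for all } (f_1,\dots,f_q)\in\mathcal{B}\}$. The Willems closure of $\mathcal{M}$ with respect to $\mathcal{F}$ is $\mathcal{M}^{\perp\perp}$. Here $\mathcal{D}/(D-a)^{m}$ means $\mathcal{D}$ modulo the ideal generated by $(D-a)^m$, and $(D-a)\mathcal{D}/(D-a)^m$ is its submodule generated by the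 class of $D-a$. The zeros of $L\in\mathcal{D}$ are the zeros in $\mathbb{C}$ of $L$ as a polynomial in $D$ (the zero polynomial vanishes everywhere). *)

theory Defs
  imports
    "HOL-Analysis.Analysis"
    "HOL-Computational_Algebra.Polynomial"
    "HOL-Algebra.Module"
    "HOL-Algebra.Ideal"
begin

section \<open>Modules over a commutative ring\<close>

text \<open>The fields \<open>mult\<close> and \<open>one\<close>, which \<^typ>\<open>('a, 'b) module\<close> inherits from rings,
  play no role for modules and are left unspecified.\<close>

definition mod_hom ::
    "('r, 's) ring_scheme \<Rightarrow> ('r, 'a, 'm) module_scheme \<Rightarrow> ('r, 'b, 'n) module_scheme \<Rightarrow> ('a \<Rightarrow> 'b) set"
  where "mod_hom R M N =
    {h \<in> carrier M \<rightarrow> carrier N.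
      (\<forall>x\<in>carrier M. \<forall>y\<in>carrier M. h (x \<oplus>\<^bsub>M\<^esub> y) = h x \<oplus>\<^bsub>N\<^esub> h y) \<and>
      (\<forall>r\<in>carrier R. \<forall>x\<in>carrier M. h (r \<odot>\<^bsub>M\<^esub> x) = r \<odot>\<^bsub>N\<^esub> h x)}"

definition mod_iso ::
    "('r, 's) ring_scheme \<Rightarrow> ('r, 'a, 'm) module_scheme \<Rightarrow> ('r, 'b, 'n) module_scheme \<Rightarrow> ('a \<Rightarrow> 'b) set"
  where "mod_iso R M N = {h \<in> mod_hom R M N. bij_betw h (carrier M) (carrier N)}"

definition quotient_module :: "('r, 'a, 'm) module_scheme \<Rightarrow> 'a set \<Rightarrow> ('r, 'a set) module"
  where "quotient_module M H =
    \<lparr>carrier = a_rcosets\<^bsub>M\<^esub> H, mult = undefined, one = undefined,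
      zero = H, add = set_add M,
      smult = (\<lambda>r X. \<Union>x\<in>X. H +>\<^bsub>M\<^esub> (r \<odot>\<^bsub>M\<^esub> x))\<rparr>"

text \<open>Only used for finite \<open>I\<close>, where no finite-support condition is needed.\<close>

definition finite_direct_sum :: "'i set \<Rightarrow> ('i \<Rightarrow> ('r, 'a, 'm) module_scheme) \<Rightarrow> ('r, 'i \<Rightarrow> 'a) module"
  where "finite_direct_sum I N =
    \<lparr>carrier = (\<Pi>\<^sub>E i\<in>I. carrier (N i)), mult = undefined, one = undefined,
      zero = (\<lambda>i\<in>I. \<zero>\<^bsub>N i\<^esub>), add = (\<lambda>u v. \<lambda>i\<in>I. u i \<oplus>\<^bsub>N i\<^esub> v i),
      smult = (\<lambda>r u. \<lambda>i\<in>I. r \<odot>\<^bsub>N i\<^esub> u i)\<rparr>"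

definition torsion_submodule :: "('r, 's) ring_scheme \<Rightarrow> ('r, 'a, 'm) module_scheme \<Rightarrow> 'a set"
  where "torsion_submodule R M = {x \<in> carrier M. \<exists>r\<in>carrier R - {\<zero>\<^bsub>R\<^esub>}. r \<odot>\<^bsub>M\<^esub> x = \<zero>\<^bsub>M\<^esub>}"

definition cyclic_submodule :: "('r, 's) ring_scheme \<Rightarrow> ('r, 'a, 'm) module_scheme \<Rightarrow> 'a \<Rightarrow> 'a set"
  where "cyclic_submodule R M x = (\<lambda>r. r \<odot>\<^bsub>M\<^esub> x) ` carrier R"

text \<open>Injectivity is the extension property for homomorphisms from submodules. A definition in HOL
  cannot quantify over types, so the test modules \<open>B\<close> range over all modules (with arbitrary
  operations) whose carrier is a set of elements of the type \<open>'b\<close>.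
  By Baer's criterion nothing is lost if \<open>'b\<close> is at least as large as the carrier of \<open>R\<close>.\<close>

definition injective_module :: "'b itself \<Rightarrow> ('r, 's) ring_scheme \<Rightarrow> ('r, 'a, 'm) module_scheme \<Rightarrow> bool"
  where "injective_module (_ :: 'b itself) R E \<longleftrightarrow>
    Module.module R E \<and>
    (\<forall>(B :: ('r, 'b) module) A. \<forall>h \<in> mod_hom R (B\<lparr>carrier := A\<rparr>) E.
      Module.module R B \<longrightarrow> submodule A R B \<longrightarrow>
      (\<exists>g \<in> mod_hom R B E. \<forall>x\<in>A. g x = h x))"

definition essential_submodule :: "('r, 's) ring_scheme \<Rightarrow> ('r, 'a, 'm) module_scheme \<Rightarrow> 'a set \<Rightarrow> bool"
  where "essential_submodule R E X \<longleftrightarrow>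
    submodule X R E \<and>
    (\<forall>N. submodule N R E \<longrightarrow> N \<noteq> {\<zero>\<^bsub>E\<^esub>} \<longrightarrow> N \<inter> X \<noteq> {\<zero>\<^bsub>E\<^esub>})"


section \<open>The ring of differential operators and its finitely generated modules\<close>

text \<open>\<open>\<complex>[D]\<close>, with \<open>D\<close> the polynomial variable \<open>[:0, 1:]\<close>.\<close>

definition DD :: "complex poly ring"
  where "DD = \<lparr>carrier = UNIV, mult = (*), one = 1, zero = 0, add = (+)\<rparr>"

definition DD_self :: "(complex poly, complex poly) module"
  where "DD_self =
    \<lparr>carrier = UNIV, mult = undefined, one = undefined, zero = 0, add = (+), smult = (*)\<rparr>"

definition DD_free :: "(complex poly, complex poly ^ 'q::finite) module"
  where "DD_free =
    \<lparr>carrier = UNIV, mult = undefined, one = undefined, zero = 0, add = (+), smult = (*s)\<rparr>"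

text \<open>\<open>\<D> / (D - a)\<^sup>m\<close>, and its submodule generated by the class of \<open>D - a\<close>.\<close>

definition DD_mod_power :: "complex \<Rightarrow> nat \<Rightarrow> (complex poly, complex poly set) module"
  where "DD_mod_power a m = quotient_module DD_self (PIdl\<^bsub>DD\<^esub> ([:-a, 1:] ^ m))"

definition DD_mod_power_sub :: "complex \<Rightarrow> nat \<Rightarrow> complex poly set set"
  where "DD_mod_power_sub a m =
    cyclic_submodule DD (DD_mod_power a m) (PIdl\<^bsub>DD\<^esub> ([:-a, 1:] ^ m) +>\<^bsub>DD_self\<^esub> [:-a, 1:])"


section \<open>Signal spaces\<close>

definition smooth :: "(real \<Rightarrow> complex) \<Rightarrow> bool"
  where "smooth f \<longleftrightarrow>
    (\<forall>n x. ((\<lambda>g y. vector_derivative g (at y)) ^^ n) f differentiable at x)"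

definition diff_D :: "(real \<Rightarrow> complex) \<Rightarrow> real \<Rightarrow> complex"
  where "diff_D f = (\<lambda>x. (1 / \<i>) * vector_derivative f (at x))"

definition op_apply :: "complex poly \<Rightarrow> (real \<Rightarrow> complex) \<Rightarrow> real \<Rightarrow> complex"
  where "op_apply p f = (\<lambda>x. \<Sum>k\<le>degree p. coeff p k * (diff_D ^^ k) f x)"

text \<open>A set of signals with its \<open>\<D>\<close>-module structure.\<close>

definition signal_module :: "(real \<Rightarrow> complex) set \<Rightarrow> (complex poly, real \<Rightarrow> complex) module"
  where "signal_module F =
    \<lparr>carrier = F, mult = undefined, one = undefined, zero = (\<lambda>x. 0),
      add = (\<lambda>f g x. f x + g x), smult = op_apply\<rparr>"

definition C_T :: "(real \<Rightarrow> complex) set"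
  where "C_T = {f. smooth f \<and> (\<forall>x. \<forall>k::int. f (x + 2 * pi * of_int k) = f x)}"

definition C_PT :: "(real \<Rightarrow> complex) set"
  where "C_PT = {f. smooth f \<and>
    (\<exists>N::nat. N \<ge> 1 \<and> (\<forall>x. \<forall>k::int. f (x + 2 * pi * real N * of_int k) = f x))}"

definition adjoin_x :: "(real \<Rightarrow> complex) set \<Rightarrow> (real \<Rightarrow> complex) set"
  where "adjoin_x X = {(\<lambda>x. \<Sum>j\<le>d. f j x * of_real x ^ j) | (d::nat) f. \<forall>j\<le>d. f j \<in> X}"

text \<open>\<open>E\<close> is an injective envelope of \<open>X\<close> inside the module \<open>Y\<close> of signals.\<close>

definition injective_envelope_in ::
    "(real \<Rightarrow> complex) set \<Rightarrow> (real \<Rightarrow> complex) set \<Rightarrow> (real \<Rightarrow> complex) set \<Rightarrow> bool"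
  where "injective_envelope_in X Y E \<longleftrightarrow>
    submodule E DD (signal_module Y) \<and>
    essential_submodule DD (signal_module E) X \<and>
    injective_module TYPE(real \<Rightarrow> complex) DD (signal_module E)"

text \<open>The explicit form of the injective envelope in \<open>X[x]\<close>; the frequencies of its
  Fourier polynomials lie in \<open>\<int>\<close> for \<open>X = C_T\<close>, and in \<open>\<rat>\<close> for \<open>X = C_PT\<close>.\<close>

definition finite_fourier :: "(real \<Rightarrow> complex) \<Rightarrow> real set \<Rightarrow> bool"
  where "finite_fourier f \<Lambda> \<longleftrightarrow>
    (\<exists>S c. finite S \<and> S \<subseteq> \<Lambda> \<and> f = (\<lambda>x. \<Sum>w\<in>S. c w * exp (\<i> * of_real (w * x))))"

definition explicit_envelope :: "(real \<Rightarrow> complex) set \<Rightarrow> real set \<Rightarrow> (real \<Rightarrow> complex) set"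
  where "explicit_envelope X \<Lambda> =
    {(\<lambda>x. \<Sum>j\<le>d. f j x * of_real x ^ j) | (d::nat) f.
      (\<forall>j\<le>d. f j \<in> X) \<and> (\<forall>j\<in>{1..d}. finite_fourier (f j) \<Lambda>)}"

definition spaces_T :: "(real \<Rightarrow> complex) set set"
  where "spaces_T = {F. F = adjoin_x C_T \<or> injective_envelope_in C_T (adjoin_x C_T) F \<or>
    F = explicit_envelope C_T \<int>}"

definition spaces_PT :: "(real \<Rightarrow> complex) set set"
  where "spaces_PT = {F. F = adjoin_x C_PT \<or> injective_envelope_in C_PT (adjoin_x C_PT) F \<or>
    F = explicit_envelope C_PT \<rat>}"


section \<open>Behaviors and the Willems closure\<close>

definition behavior ::
    "(real \<Rightarrow> complex) set \<Rightarrow> (complex poly ^ 'q::finite) set \<Rightarrow> ((real \<Rightarrow> complex) ^ 'q) set"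
  where "behavior F M =
    {f. (\<forall>j. f $ j \<in> F) \<and> (\<forall>r\<in>M. \<forall>x. (\<Sum>j\<in>UNIV. op_apply (r $ j) (f $ j) x) = 0)}"

definition annihilator :: "((real \<Rightarrow> complex) ^ 'q::finite) set \<Rightarrow> (complex poly ^ 'q) set"
  where "annihilator B = {r. \<forall>f\<in>B. \<forall>x. (\<Sum>j\<in>UNIV. op_apply (r $ j) (f $ j) x) = 0}"

definition willems_closure ::
    "(real \<Rightarrow> complex) set \<Rightarrow> (complex poly ^ 'q::finite) set \<Rightarrow> (complex poly ^ 'q) set"
  where "willems_closure F M = annihilator (behavior F M)"

text \<open>\<open>M\<^sup>\<bottom>\<^sup>\<bottom> / M\<close>, as a subset of \<open>\<D>\<^sup>q / M\<close>.\<close>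

definition closure_quotient ::
    "(real \<Rightarrow> complex) set \<Rightarrow> (complex poly ^ 'q::finite) set \<Rightarrow> (complex poly ^ 'q) set set"
  where "closure_quotient F M = (\<lambda>r. M +>\<^bsub>DD_free\<^esub> r) ` willems_closure F M"

end

theory Submission
  imports Defs "HOL-Computational_Algebra.Polynomial_Factorial"
    "HOL-Computational_Algebra.Fundamental_Theorem_Algebra"
begin

text \<open>A homomorphism from \<open>\<D>\<^sup>q / M\<close> to the signal space is an element of the behavior, so an operator
  \<open>r\<close> lies in the closure iff all these homomorphisms kill its class. On the one hand, if
  \<open>r \<notin> M + (D - a)\<^sup>m \<D>\<^sup>q\<close>, a complex-linear functional separates the two, and such a functional is
  evaluation at \<open>0\<close> on a tuple of signals \<open>Q(x) exp(\<i> a x)\<close> with \<open>degree Q < m\<close>; the periodic spaces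
  contain these for \<open>m = 1\<close>, their extensions by \<open>x\<close> for all \<open>m\<close>. Operators outside the torsion are
  detected over the field of fractions of \<open>\<D>\<close>. On the other hand, restricting a signal
  \<open>c exp(\<i> a x)\<close> of \<open>C_T[x]\<close> to an arithmetic progression of periods gives a sequence that is
  both geometric and polynomial, so that \<open>D - a\<close> is injective unless \<open>a\<close> is a frequency; and on
  periodic signals \<open>(D - a)\<^sup>2 f = 0\<close> forces \<open>(D - a) f = 0\<close>.\<close>

section \<open>Smooth functions and differential operators\<close>

text \<open>Every extended signal space enters through two bounds only: it contains all exponential
  polynomials whose frequency is admissible, and it lies in \<open>X[x]\<close>, where D - a is
  injective for every other a. So one argument covers \<open>X[x]\<close>, the explicit envelope and
  any abstract injective envelope; injectivity of the latter serves to show that it contains these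
  functions. Both families of periods are treated at once through a multiplicative set
  \<open>P\<close> of multiples of 2 pi. The isomorphism \<phi> is replaced by lifts
  \<open>e i\<close> of the generators to operators, so that a torsion class becomes a combination
  of the \<open>e i\<close> with coefficients \<open>p i\<close>, and membership in the closure
  becomes a condition on each \<open>p i\<close> separately. At a frequency \<open>a i\<close>,
  separation modulo the m-th power of D - \<open>a i\<close> forces this power to divide
  \<open>p i\<close>, with m = 1 for periodic signals and m = \<open>n i\<close> once powers of x
  are present. Elsewhere \<open>p i\<close> is free, because an injective operator kills the signal
  that \<open>e i\<close> produces. The answers thus differ by the size of the Jordan blocks of D
  that the signal space admits at a frequency.\<close>

lemma smoothI:
  assumes "f \<in> S"
    and "\<And>g x. g \<in> S \<Longrightarrow> g differentiable at x"
    and "\<And>g. g \<in> S \<Longrightarrow> (\<lambda>y. vector_derivative g (at y)) \<in> S"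
  shows "smooth f"
proof -
  have "((\<lambda>g y. vector_derivative g (at y)) ^^ n) f \<in> S" for n
    by (induction n) (use assms in auto)
  then show ?thesis
    using assms(2) by (auto simp: smooth_def)
qed

lemma smooth_differentiable: "smooth f \<Longrightarrow> f differentiable at x"
  unfolding smooth_def by (metis funpow_0)

lemma smooth_vector_derivative: "smooth f \<Longrightarrow> smooth (\<lambda>y. vector_derivative f (at y))"
  unfolding smooth_def by (metis (mono_tags, lifting) comp_apply funpow_Suc_right)

text \<open>\<open>smoothI\<close> asks for a set stable under differentiation. Products of two
  smooth functions do not form one, but the algebra generated by the smooth functions does, by the
  Leibniz rule; hence it contains nothing new.\<close>

inductive_set smooth_algebra :: "(real \<Rightarrow> complex) set" where
  base: "smooth f \<Longrightarrow> f \<in> smooth_algebra"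
| add: "f \<in> smooth_algebra \<Longrightarrow> g \<in> smooth_algebra \<Longrightarrow> (\<lambda>x. f x + g x) \<in> smooth_algebra"
| mult: "f \<in> smooth_algebra \<Longrightarrow> g \<in> smooth_algebra \<Longrightarrow> (\<lambda>x. f x * g x) \<in> smooth_algebra"

lemma smooth_algebra_derivative:
  "f \<in> smooth_algebra \<Longrightarrow>
    (\<forall>x. f differentiable at x) \<and> (\<lambda>y. vector_derivative f (at y)) \<in> smooth_algebra"
proof (induction rule: smooth_algebra.induct)
  case (base f)
  then show ?case
    by (auto intro: smooth_algebra.base smooth_differentiable smooth_vector_derivative)
next
  case (add f g)
  then have "(\<lambda>y. vector_derivative (\<lambda>x. f x + g x) (at y)) =
      (\<lambda>y. vector_derivative f (at y) + vector_derivative g (at y))"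
    by simp
  with add show ?case
    by (auto intro: smooth_algebra.intros)
next
  case (mult f g)
  then have "(\<lambda>y. vector_derivative (\<lambda>x. f x * g x) (at y)) =
      (\<lambda>y. f y * vector_derivative g (at y) + vector_derivative f (at y) * g y)"
    by simp
  with mult show ?case
    by (auto intro: smooth_algebra.intros)
qed

lemma smooth_algebra_eq: "smooth_algebra = Collect smooth"
  using smooth_algebra_derivative by (auto intro: smooth_algebra.base smoothI)

lemma smooth_add: "smooth f \<Longrightarrow> smooth g \<Longrightarrow> smooth (\<lambda>x. f x + g x)"
  using smooth_algebra.add smooth_algebra_eq by auto

lemma smooth_mult: "smooth f \<Longrightarrow> smooth g \<Longrightarrow> smooth (\<lambda>x. f x * g x)"
  using smooth_algebra.mult smooth_algebra_eq by auto

lemma smooth_const [simp]: "smooth (\<lambda>x. c)"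
  by (rule smoothI[where S = "range (\<lambda>c x. c)"]) auto

lemma smooth_cmult: "smooth f \<Longrightarrow> smooth (\<lambda>x. c * f x)"
  by (intro smooth_mult smooth_const)

lemma smooth_sum: "(\<And>i. i \<in> A \<Longrightarrow> smooth (f i)) \<Longrightarrow> smooth (\<lambda>x. \<Sum>i\<in>A. f i x)"
  by (induction A rule: infinite_finite_induct) (auto intro: smooth_add)

lemma smooth_diff_D: "smooth f \<Longrightarrow> smooth (diff_D f)"
  unfolding diff_D_def by (intro smooth_cmult smooth_vector_derivative)

lemma diff_D_add: "smooth f \<Longrightarrow> smooth g \<Longrightarrow>
    diff_D (\<lambda>x. f x + g x) = (\<lambda>x. diff_D f x + diff_D g x)"
  by (simp add: diff_D_def smooth_differentiable algebra_simps)

lemma diff_D_cmult: "smooth f \<Longrightarrow> diff_D (\<lambda>x. c * f x) = (\<lambda>x. c * diff_D f x)"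
  by (simp add: diff_D_def smooth_differentiable mult.left_commute)

lemma op_apply_upto:
  assumes "degree p \<le> n"
  shows "op_apply p f x = (\<Sum>k\<le>n. coeff p k * (diff_D ^^ k) f x)"
  unfolding op_apply_def
  by (rule sum.mono_neutral_left) (use assms in \<open>auto simp: coeff_eq_0\<close>)

lemma op_apply_add: "op_apply (p + q) f x = op_apply p f x + op_apply q f x"
proof -
  define n where "n = max (degree p) (degree q)"
  have "degree (p + q) \<le> n" "degree p \<le> n" "degree q \<le> n"
    by (auto simp: n_def degree_add_le)
  then show ?thesis
    by (simp add: op_apply_upto[of _ n] sum.distrib ring_distribs)
qed

lemma op_apply_0 [simp]: "op_apply 0 f x = 0"
  by (simp add: op_apply_def)

lemma op_apply_1 [simp]: "op_apply 1 f = f"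
  by (simp add: op_apply_def)

text \<open>Horner recursion. It moves \<open>diff_D\<close> onto the signal, so inductions on
  \<open>p\<close> have to generalise over \<open>f\<close>.\<close>

lemma op_apply_pCons: "op_apply (pCons c p) f x = c * f x + op_apply p (diff_D f) x"
proof -
  have "degree (pCons c p) \<le> Suc (degree p)"
    by (rule degree_pCons_le)
  then have "op_apply (pCons c p) f x = (\<Sum>k\<le>Suc (degree p). coeff (pCons c p) k * (diff_D ^^ k) f x)"
    by (rule op_apply_upto)
  also have "\<dots> = c * f x + op_apply p (diff_D f) x"
    by (subst sum.atMost_Suc_shift) (simp add: op_apply_def funpow_swap1)
  finally show ?thesis .
qed

lemma op_apply_const [simp]: "op_apply [:c:] f x = c * f x"
  by (simp add: op_apply_pCons)

lemma op_apply_linear: "op_apply [:- a, 1:] f x = diff_D f x - a * f x"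
  by (simp add: op_apply_pCons)

lemma smooth_op_apply: "smooth f \<Longrightarrow> smooth (op_apply p f)"
proof (induction p arbitrary: f)
  case (pCons c p)
  have "op_apply (pCons c p) f = (\<lambda>x. c * f x + op_apply p (diff_D f) x)"
    by (simp add: op_apply_pCons fun_eq_iff)
  then show ?case
    using pCons by (simp add: smooth_add smooth_cmult smooth_diff_D)
qed (simp add: op_apply_def)

lemma op_apply_fun_add: "smooth f \<Longrightarrow> smooth g \<Longrightarrow>
    op_apply p (\<lambda>x. f x + g x) y = op_apply p f y + op_apply p g y"
proof (induction p arbitrary: f g)
  case (pCons c p)
  then show ?case
    by (simp add: op_apply_pCons diff_D_add smooth_diff_D algebra_simps)
qed simp

lemma op_apply_fun_cmult: "smooth f \<Longrightarrow> op_apply p (\<lambda>x. c * f x) y = c * op_apply p f y"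
proof (induction p arbitrary: f)
  case (pCons c p)
  then show ?case
    by (simp add: op_apply_pCons diff_D_cmult smooth_diff_D algebra_simps)
qed simp

lemma op_apply_fun_0 [simp]: "op_apply p (\<lambda>x. 0) y = 0"
  using op_apply_fun_cmult[of "\<lambda>x. 0" p 0 y] by simp

lemma op_apply_fun_sum:
  "(\<And>i. i \<in> A \<Longrightarrow> smooth (f i)) \<Longrightarrow>
    op_apply p (\<lambda>x. \<Sum>i\<in>A. f i x) y = (\<Sum>i\<in>A. op_apply p (f i) y)"
  by (induction A rule: infinite_finite_induct) (auto simp: op_apply_fun_add smooth_sum)

lemma diff_D_op_apply: "smooth f \<Longrightarrow> diff_D (op_apply p f) = op_apply p (diff_D f)"
proof (induction p arbitrary: f)
  case 0
  have "op_apply 0 f = (\<lambda>x. 0)" "op_apply 0 (diff_D f) = (\<lambda>x. 0)"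
    by (simp_all add: fun_eq_iff)
  then show ?case
    by (simp add: diff_D_def)
next
  case (pCons c p)
  have "op_apply (pCons c p) g = (\<lambda>x. c * g x + op_apply p (diff_D g) x)" for g
    by (simp add: op_apply_pCons fun_eq_iff)
  then show ?case
    using pCons by (simp add: diff_D_add diff_D_cmult smooth_cmult smooth_diff_D smooth_op_apply)
qed

lemma op_apply_mult: "smooth f \<Longrightarrow> op_apply (p * q) f = op_apply p (op_apply q f)"
proof (induction p arbitrary: f)
  case 0
  then show ?case
    by (simp add: fun_eq_iff)
next
  case (pCons c p)
  have "op_apply (pCons c p * q) f x = op_apply (pCons c p) (op_apply q f) x" for x
  proof -
    have "pCons c p * q = [:c:] * q + pCons 0 (p * q)"
      by simp
    then have "op_apply (pCons c p * q) f x =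
        op_apply ([:c:] * q) f x + op_apply p (op_apply q (diff_D f)) x"
      using pCons by (simp only: op_apply_add op_apply_pCons smooth_diff_D) simp
    moreover have "op_apply ([:c:] * q) f x = c * op_apply q f x"
      by (simp add: op_apply_def sum_distrib_left mult.assoc)
    ultimately show ?thesis
      using pCons by (simp add: op_apply_pCons diff_D_op_apply)
  qed
  then show ?case
    by auto
qed

text \<open>The pairing that \<open>behavior\<close> and \<open>annihilator\<close> write out; both
  become orthogonality with respect to it.\<close>

definition act :: "complex poly ^ 'q::finite \<Rightarrow> (real \<Rightarrow> complex) ^ 'q \<Rightarrow> real \<Rightarrow> complex"
  where "act r f = (\<lambda>x. \<Sum>j\<in>UNIV. op_apply (r $ j) (f $ j) x)"

lemma act_add: "act (r + s) f x = act r f x + act s f x"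
  by (simp add: act_def op_apply_add sum.distrib)

lemma act_0 [simp]: "act 0 f x = 0"
  by (simp add: act_def)

lemma act_sum: "act (\<Sum>i\<in>A. r i) f x = (\<Sum>i\<in>A. act (r i) f x)"
  by (induction A rule: infinite_finite_induct) (auto simp: act_add)

lemma act_smult: "(\<And>j. smooth (f $ j)) \<Longrightarrow> act (p *s r) f = op_apply p (act r f)"
  by (simp add: act_def fun_eq_iff op_apply_mult op_apply_fun_sum smooth_op_apply)

lemma in_behavior_iff: "f \<in> behavior F M \<longleftrightarrow> (\<forall>j. f $ j \<in> F) \<and> (\<forall>r\<in>M. \<forall>x. act r f x = 0)"
  by (simp add: behavior_def act_def)

lemma in_willems_closure_iff:
  "r \<in> willems_closure F M \<longleftrightarrow> (\<forall>f\<in>behavior F M. \<forall>x. act r f x = 0)"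
  by (simp add: willems_closure_def annihilator_def act_def)


section \<open>Exponential polynomials\<close>

text \<open>These are the generalised eigenvectors of D for the eigenvalue \<open>a\<close>: each is
  killed by some power of D - a.\<close>

definition exp_poly :: "complex \<Rightarrow> complex poly \<Rightarrow> real \<Rightarrow> complex"
  where "exp_poly a Q = (\<lambda>x. poly Q (of_real x) * exp (\<i> * a * of_real x))"

lemma exp_poly_has_vector_derivative:
  "(exp_poly a Q has_vector_derivative exp_poly a ([:\<i> * a:] * Q + pderiv Q) x) (at x)"
proof -
  have "((\<lambda>z. poly Q z * exp (\<i> * a * z)) has_field_derivative
      poly ([:\<i> * a:] * Q + pderiv Q) z * exp (\<i> * a * z)) (at z)" for z
    by (auto intro!: derivative_eq_intros simp: algebra_simps)
  from has_vector_derivative_real_field[OF this] show ?thesis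
    by (simp add: exp_poly_def)
qed

lemma smooth_exp_poly: "smooth (exp_poly a Q)"
proof (rule smoothI[where S = "range (exp_poly a)"])
  show "(\<lambda>y. vector_derivative g (at y)) \<in> range (exp_poly a)" if "g \<in> range (exp_poly a)" for g
    using that vector_derivative_at[OF exp_poly_has_vector_derivative] by auto
qed (auto intro: differentiableI_vector exp_poly_has_vector_derivative)

lemma exp_poly_add: "exp_poly a (P + Q) x = exp_poly a P x + exp_poly a Q x"
  by (simp add: exp_poly_def algebra_simps)

lemma exp_poly_cmult: "exp_poly a ([:c:] * P) x = c * exp_poly a P x"
  by (simp add: exp_poly_def algebra_simps)

lemma diff_D_exp_poly: "diff_D (exp_poly a Q) = exp_poly a ([:a:] * Q + [:- \<i>:] * pderiv Q)"
  unfolding diff_D_def vector_derivative_at[OF exp_poly_has_vector_derivative]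
  by (simp add: exp_poly_def fun_eq_iff field_simps)

lemma op_apply_exp_poly: "op_apply p (exp_poly a Q) \<in> range (exp_poly a)"
proof (induction p arbitrary: Q)
  case 0
  have "op_apply 0 (exp_poly a Q) = exp_poly a 0"
    by (simp add: fun_eq_iff exp_poly_def)
  then show ?case
    by blast
next
  case (pCons c p)
  then obtain R where R: "op_apply p (diff_D (exp_poly a Q)) = exp_poly a R"
    unfolding diff_D_exp_poly by blast
  have "op_apply (pCons c p) (exp_poly a Q) = exp_poly a ([:c:] * Q + R)"
    by (simp only: fun_eq_iff op_apply_pCons R exp_poly_add exp_poly_cmult) simp
  then show ?case
    by blast
qed

lemma act_exp_poly:
  assumes "\<And>j. f $ j \<in> range (exp_poly a)"
  shows "act r f \<in> range (exp_poly a)"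
proof -
  have "\<exists>R. op_apply (r $ j) (f $ j) = exp_poly a R" for j
    using assms[of j] op_apply_exp_poly[of "r $ j" a] by (metis (no_types) image_iff)
  then obtain R where R: "\<And>j. op_apply (r $ j) (f $ j) = exp_poly a (R j)"
    by metis
  have "act r f = exp_poly a (\<Sum>j\<in>UNIV. R j)"
    by (simp add: act_def R fun_eq_iff exp_poly_def poly_sum sum_distrib_right)
  then show ?thesis
    by blast
qed

lemma op_apply_exp: "op_apply p (exp_poly a [:c:]) = exp_poly a [:poly p a * c:]"
proof (induction p arbitrary: c)
  case (pCons d p)
  have "diff_D (exp_poly a [:c:]) = exp_poly a [:a * c:]"
    by (simp add: diff_D_exp_poly pderiv_pCons mult.commute)
  with pCons.IH[of "a * c"] have
    "op_apply (pCons d p) (exp_poly a [:c:]) x = d * exp_poly a [:c:] x + exp_poly a [:poly p a * (a * c):] x" for x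
    by (simp only: op_apply_pCons)
  then show ?case
    by (simp add: fun_eq_iff) (simp add: exp_poly_def algebra_simps)
qed (simp add: fun_eq_iff exp_poly_def)

text \<open>Conjugation by the exponential turns D - a into D, which acts on the factor
  \<open>Q\<close> as \<open>- \<i>\<close> times the derivative.\<close>

lemma op_apply_linear_exp_poly:
  "op_apply [:- a, 1:] (exp_poly a Q) = exp_poly a ([:- \<i>:] * pderiv Q)"
  by (simp add: fun_eq_iff op_apply_linear diff_D_exp_poly) (simp add: exp_poly_def algebra_simps)

lemma op_apply_linear_power_exp_poly:
  "op_apply ([:- a, 1:] ^ k) (exp_poly a Q) = exp_poly a ([:(- \<i>) ^ k:] * (pderiv ^^ k) Q)"
proof (induction k arbitrary: Q)
  case (Suc k)
  have "(pderiv ^^ k) ([:- \<i>:] * pderiv Q) = [:- \<i>:] * (pderiv ^^ k) (pderiv Q)"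
    by (simp add: higher_pderiv_smult flip: smult_minus_left)
  moreover have "[:(- \<i>) ^ k:] * ([:- \<i>:] * X) = [:(- \<i>) ^ Suc k:] * X" for X :: "complex poly"
    by (simp add: mult.commute)
  ultimately show ?case
    by (simp only: power_Suc2 op_apply_mult smooth_exp_poly op_apply_linear_exp_poly Suc)
      (simp add: funpow_swap1)
qed simp

lemma higher_pderiv_at_0: "poly ((pderiv ^^ k) Q) 0 = fact k * coeff Q k"
  for Q :: "complex poly"
  by (simp add: poly_0_coeff_0 coeff_higher_pderiv pochhammer_fact)

text \<open>All coefficients of \<open>Q\<close> can thus be read off at the single point 0. This is
  used both to build a signal with prescribed values and to prove that an exponential polynomial
  vanishes.\<close>

lemma op_apply_linear_power_exp_poly_0:
  "op_apply ([:- a, 1:] ^ k) (exp_poly a Q) 0 = (- \<i>) ^ k * fact k * coeff Q k"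
  by (simp add: op_apply_linear_power_exp_poly) (simp add: exp_poly_def higher_pderiv_at_0)

lemma linear_kernel:
  assumes "smooth f" "\<And>x. op_apply [:- a, 1:] f x = 0"
  obtains c where "f = exp_poly a [:c:]"
proof -
  \<comment> \<open>Integrating factor: the derivative of \<open>h\<close> vanishes because f' = i a
    f.\<close>
  define h where "h = (\<lambda>x. exp_poly (- a) 1 x * f x)"
  have "(h has_vector_derivative 0) (at x)" for x
  proof -
    have "vector_derivative f (at x) = \<i> * a * f x"
      using assms(2)[of x] by (simp add: op_apply_linear diff_D_def) (simp add: field_simps complex_eq_iff)
    then have "(f has_vector_derivative \<i> * a * f x) (at x)"
      using smooth_differentiable[OF assms(1), of x] vector_derivative_works by metis
    from has_vector_derivative_mult[OF exp_poly_has_vector_derivative[of "- a" 1 x] this]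
    show ?thesis
      by (simp add: h_def exp_poly_def algebra_simps)
  qed
  then have "\<exists>c. \<forall>x\<in>UNIV. h x = c"
    using has_vector_derivative_zero_constant[of UNIV h] by (metis UNIV_I convex_UNIV)
  then obtain c where c: "\<And>x. h x = c"
    by auto
  have "f x = exp_poly a [:c:] x" for x
  proof -
    have "exp_poly a 1 x * exp_poly (- a) 1 x = 1"
      by (simp add: exp_poly_def flip: exp_add)
    then have "f x = exp_poly a 1 x * h x"
      by (simp add: h_def mult.assoc[symmetric])
    then show ?thesis
      by (simp add: c) (simp add: exp_poly_def)
  qed
  then show ?thesis
    using that by blast
qed

section \<open>Periodic signals\<close>

definition has_period :: "nat \<Rightarrow> (real \<Rightarrow> complex) \<Rightarrow> bool"
  where "has_period N f \<longleftrightarrow> (\<forall>x. \<forall>k::int. f (x + 2 * pi * real N * of_int k) = f x)"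

text \<open>One encoding for \<open>C_T\<close>, where \<open>P\<close> is \<open>{1}\<close>, and
  for \<open>C_PT\<close>, where \<open>P\<close> is \<open>{1..}\<close>.\<close>

definition periodic_signals :: "nat set \<Rightarrow> (real \<Rightarrow> complex) set"
  where "periodic_signals P = {f. smooth f \<and> (\<exists>N\<in>P. has_period N f)}"

text \<open>Those \<open>a\<close> for which exp(i a x) has period 2 pi N for some N in
  \<open>P\<close>. They are kept complex so as to be compared with zeros of operators.\<close>

definition frequencies :: "nat set \<Rightarrow> complex set"
  where "frequencies P = {a. \<exists>N\<in>P. of_nat N * a \<in> \<int>}"

lemma C_T_eq: "C_T = periodic_signals {1}"
  by (simp add: C_T_def periodic_signals_def has_period_def)

lemma C_PT_eq: "C_PT = periodic_signals {1..}"
  by (auto simp: C_PT_def periodic_signals_def has_period_def)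

lemma frequencies_1: "frequencies {1} = \<int>"
  by (simp add: frequencies_def)

lemma frequencies_ge_1: "frequencies {1..} = \<rat>"
proof (intro equalityI subsetI)
  fix a assume "a \<in> frequencies {1..}"
  then obtain N :: nat and m where "N \<ge> 1" "of_nat N * a = of_int m"
    by (auto simp: frequencies_def elim!: Ints_cases)
  then have "a = of_int m / of_nat N"
    by (simp add: field_simps)
  then show "a \<in> \<rat>"
    by simp
next
  fix a :: complex assume "a \<in> \<rat>"
  then obtain m n :: int where "n > 0" "a = of_int m / of_int n"
    by (rule Rats_cases')
  then have "of_nat (nat n) * a = of_int m" "nat n \<ge> 1"
    by auto
  then show "a \<in> frequencies {1..}"
    unfolding frequencies_def by (metis (mono_tags, lifting) Ints_of_int atLeast_iff mem_Collect_eq)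
qed

lemma has_period_mult: "has_period N f \<Longrightarrow> has_period (N * N') f"
proof (unfold has_period_def, intro allI)
  fix x :: real and k :: int
  assume "\<forall>x. \<forall>k::int. f (x + 2 * pi * real N * of_int k) = f x"
  then have "f (x + 2 * pi * real N * of_int (int N' * k)) = f x"
    by blast
  then show "f (x + 2 * pi * real (N * N') * of_int k) = f x"
    by (simp add: mult.assoc)
qed

lemma has_period_vector_derivative:
  assumes "has_period N f" and "smooth f"
  shows "has_period N (\<lambda>y. vector_derivative f (at y))"
  unfolding has_period_def
proof (intro allI)
  fix x :: real and k :: int
  let ?c = "2 * pi * real N * of_int k"
  have "(f has_vector_derivative vector_derivative f (at (x + ?c))) (at (x + ?c))"
    using smooth_differentiable[OF assms(2)] vector_derivative_works by blast
  moreover have "((\<lambda>x. x + ?c) has_vector_derivative 1) (at x)"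
    by (auto intro!: derivative_eq_intros)
  ultimately have "(f \<circ> (\<lambda>x. x + ?c) has_vector_derivative 1 *\<^sub>R vector_derivative f (at (x + ?c))) (at x)"
    by (intro vector_diff_chain_at) auto
  moreover have "f \<circ> (\<lambda>x. x + ?c) = f"
    using assms(1) by (auto simp: has_period_def)
  ultimately show "vector_derivative f (at (x + ?c)) = vector_derivative f (at x)"
    by (simp add: vector_derivative_at)
qed

lemma smooth_power_of_real: "smooth (\<lambda>x. of_real x ^ j)"
proof -
  have "(\<lambda>x. complex_of_real x ^ j) = exp_poly 0 (monom 1 j)"
    by (simp add: exp_poly_def poly_monom)
  then show ?thesis
    using smooth_exp_poly by metis
qed

lemma diff_D_mult_power:
  assumes "smooth f"
  shows "diff_D (\<lambda>x. f x * of_real x ^ j) =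
    (\<lambda>x. diff_D f x * of_real x ^ j + (- \<i> * of_nat j) * f x * of_real x ^ (j - 1))"
proof
  fix x
  have "((\<lambda>x. complex_of_real x ^ j) has_vector_derivative of_nat j * of_real x ^ (j - 1)) (at x)"
    by (rule has_vector_derivative_real_field) (auto intro!: derivative_eq_intros)
  moreover have "(f has_vector_derivative vector_derivative f (at x)) (at x)"
    using smooth_differentiable[OF assms] vector_derivative_works by blast
  ultimately have "vector_derivative (\<lambda>x. f x * of_real x ^ j) (at x) =
      f x * (of_nat j * of_real x ^ (j - 1)) + vector_derivative f (at x) * of_real x ^ j"
    by (intro vector_derivative_at has_vector_derivative_mult)
  then show "diff_D (\<lambda>x. f x * of_real x ^ j) x =
      diff_D f x * of_real x ^ j + (- \<i> * of_nat j) * f x * of_real x ^ (j - 1)"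
    by (simp add: diff_D_def algebra_simps)
qed

text \<open>R(t + 1) = w R(t) holds at infinitely many t, hence as an identity of polynomials. A
  shift preserves the leading coefficient, which is nonzero since \<open>c\<close> is, so w =
  1.\<close>

lemma geometric_eq_polynomial:
  fixes R :: "complex poly"
  assumes "\<And>t::nat. poly R (of_nat t) = c * w ^ t" and "c \<noteq> 0"
  shows "w = 1"
proof -
  define S where "S = pcompose R [:1, 1:] - [:w:] * R"
  have "poly S (of_nat t) = 0" for t
    using assms(1)[of t] assms(1)[of "Suc t"] by (simp add: S_def poly_pcompose add.commute)
  then have "range of_nat \<subseteq> {z. poly S z = 0}"
    by auto
  moreover have "infinite (range (of_nat :: nat \<Rightarrow> complex))"
    by (simp add: finite_image_iff inj_of_nat)
  ultimately have "S = 0"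
    using poly_roots_finite finite_subset by blast
  then have "lead_coeff (pcompose R [:1, 1:]) = lead_coeff ([:w:] * R)"
    by (simp add: S_def)
  moreover have "lead_coeff (pcompose R [:1, 1:]) = lead_coeff R"
    by (subst lead_coeff_comp) simp_all
  moreover have "lead_coeff ([:w:] * R) = w * lead_coeff R"
    by (simp add: lead_coeff_mult del: mult_pCons_left)
  ultimately have "lead_coeff R = w * lead_coeff R"
    by simp
  moreover have "R \<noteq> 0"
    using assms(1)[of 0] assms(2) by auto
  ultimately show ?thesis
    by simp
qed

text \<open>Closure under products gives finite families a common period, hence sums a period.
  Positivity excludes N = 0, for which \<open>has_period\<close> holds of every function.\<close>

locale period_set =
  fixes P :: "nat set"
  assumes one_mem: "1 \<in> P"
    and mult_mem: "N \<in> P \<Longrightarrow> N' \<in> P \<Longrightarrow> N * N' \<in> P"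
    and pos: "N \<in> P \<Longrightarrow> N > 0"
begin

abbreviation X where "X \<equiv> periodic_signals P"
abbreviation \<Lambda> where "\<Lambda> \<equiv> frequencies P"

lemma Ints_subset: "\<int> \<subseteq> \<Lambda>"
  unfolding frequencies_def using one_mem by (auto intro!: bexI[of _ 1])

lemma smooth_X: "f \<in> X \<Longrightarrow> smooth f"
  by (simp add: periodic_signals_def)

lemma common_period:
  assumes "finite A" and "A \<subseteq> X"
  shows "\<exists>N\<in>P. \<forall>f\<in>A. has_period N f"
  using assms
proof (induction A rule: finite_induct)
  case empty
  then show ?case
    using one_mem by auto
next
  case (insert g A)
  then obtain N N' where "N \<in> P" "N' \<in> P" "\<forall>f\<in>A. has_period N f" "has_period N' g"
    by (auto simp: periodic_signals_def)
  then have "\<forall>f\<in>insert g A. has_period (N * N') f"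
    using has_period_mult by (metis insertE mult.commute)
  then show ?case
    using mult_mem \<open>N \<in> P\<close> \<open>N' \<in> P\<close> by blast
qed

lemma X_0: "(\<lambda>x. 0) \<in> X"
  using one_mem by (auto simp: periodic_signals_def has_period_def)

lemma X_add:
  assumes "f \<in> X" "g \<in> X"
  shows "(\<lambda>x. f x + g x) \<in> X"
proof -
  obtain N where "N \<in> P" "has_period N f" "has_period N g"
    using common_period[of "{f, g}"] assms by auto
  then show ?thesis
    using assms unfolding periodic_signals_def
    by (auto simp: has_period_def intro!: smooth_add bexI[of _ N])
qed

lemma X_cmult: "f \<in> X \<Longrightarrow> (\<lambda>x. c * f x) \<in> X"
  by (auto simp: periodic_signals_def has_period_def intro!: smooth_cmult)

lemma X_diff_D: "f \<in> X \<Longrightarrow> diff_D f \<in> X"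
proof -
  assume "f \<in> X"
  then obtain N where "N \<in> P" "smooth f" "has_period N f"
    by (auto simp: periodic_signals_def)
  moreover from this have "has_period N (\<lambda>y. vector_derivative f (at y))"
    by (intro has_period_vector_derivative)
  then have "has_period N (diff_D f)"
    by (simp add: has_period_def diff_D_def)
  ultimately show ?thesis
    by (auto simp: periodic_signals_def smooth_diff_D)
qed

lemma exp_in_X:
  assumes "a \<in> \<Lambda>"
  shows "exp_poly a [:c:] \<in> X"
proof -
  obtain N m where N: "N \<in> P" "of_nat N * a = of_int m"
    using assms by (auto simp: frequencies_def elim!: Ints_cases)
  have "exp (\<i> * a * of_real (x + 2 * pi * real N * of_int k)) = exp (\<i> * a * of_real x)"
    for x :: real and k :: int
  proof -
    have "\<i> * a * of_real (x + 2 * pi * real N * of_int k) =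
        \<i> * a * of_real x + 2 * of_int (m * k) * of_real pi * \<i>"
    proof -
      have "\<i> * a * of_real (x + 2 * pi * real N * of_int k) =
          \<i> * a * of_real x + 2 * ((of_nat N * a) * of_int k) * of_real pi * \<i>"
        by (simp add: algebra_simps)
      then show ?thesis
        by (simp add: N(2))
    qed
    then show ?thesis
      using exp_integer_2pi[of "of_int (m * k)"] by (simp add: exp_add mult_ac)
  qed
  then show ?thesis
    using N(1) smooth_exp_poly[of a "[:c:]"]
    by (auto simp: periodic_signals_def has_period_def exp_poly_def)
qed

lemma adjoin_x_obtain:
  assumes "f \<in> adjoin_x X"
  obtains d g where "f = (\<lambda>x. \<Sum>j\<le>d. g j x * of_real x ^ j)" "\<And>j. g j \<in> X"
proof -
  obtain d g where f: "f = (\<lambda>x. \<Sum>j\<le>d. g j x * of_real x ^ j)" "\<forall>j\<le>d. g j \<in> X"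
    using assms by (auto simp: adjoin_x_def)
  show ?thesis
    by (rule that[where d = d and g = "\<lambda>j. if j \<le> d then g j else (\<lambda>x. 0)"]) (use f X_0 in auto)
qed

lemma adjoin_xI: "(\<And>j. j \<le> d \<Longrightarrow> g j \<in> X) \<Longrightarrow> (\<lambda>x. \<Sum>j\<le>d. g j x * of_real x ^ j) \<in> adjoin_x X"
  by (auto simp: adjoin_x_def)

lemma adjoin_x_mult_power:
  assumes "f \<in> X"
  shows "(\<lambda>x. f x * of_real x ^ j) \<in> adjoin_x X"
proof -
  have "(\<lambda>x. f x * of_real x ^ j) =
      (\<lambda>x. \<Sum>i\<le>j. (if i = j then f else (\<lambda>x. 0)) x * complex_of_real x ^ i)"
    by (simp add: fun_eq_iff if_distrib[of "\<lambda>f. f _"] if_distrib[of "\<lambda>z. z * _"] cong: if_cong)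
  then show ?thesis
    using assms X_0 adjoin_xI[of j "\<lambda>i. if i = j then f else (\<lambda>x. 0)"] by auto
qed

lemma X_subset_adjoin_x: "X \<subseteq> adjoin_x X"
  using adjoin_x_mult_power[of _ 0] by auto

lemma adjoin_x_add:
  assumes "f \<in> adjoin_x X" "g \<in> adjoin_x X"
  shows "(\<lambda>x. f x + g x) \<in> adjoin_x X"
proof -
  obtain d u where u: "f = (\<lambda>x. \<Sum>j\<le>d. u j x * of_real x ^ j)" "\<And>j. u j \<in> X"
    using adjoin_x_obtain[OF assms(1)] by metis
  obtain e v where v: "g = (\<lambda>x. \<Sum>j\<le>e. v j x * of_real x ^ j)" "\<And>j. v j \<in> X"
    using adjoin_x_obtain[OF assms(2)] by metis
  define w where "w = (\<lambda>j x. (if j \<le> d then u j x else 0) + (if j \<le> e then v j x else 0))"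
  have "(\<Sum>j\<le>d. u j x * of_real x ^ j) =
      (\<Sum>j\<le>max d e. (if j \<le> d then u j x else 0) * of_real x ^ j)" for x
    by (rule sum.mono_neutral_cong_left) auto
  moreover have "(\<Sum>j\<le>e. v j x * of_real x ^ j) =
      (\<Sum>j\<le>max d e. (if j \<le> e then v j x else 0) * of_real x ^ j)" for x
    by (rule sum.mono_neutral_cong_left) auto
  ultimately have "(\<lambda>x. f x + g x) = (\<lambda>x. \<Sum>j\<le>max d e. w j x * of_real x ^ j)"
    by (simp add: u(1) v(1) w_def ring_distribs sum.distrib)
  moreover have "w j \<in> X" for j
    unfolding w_def using u(2)[of j] v(2)[of j] X_0
    by (cases "j \<le> d"; cases "j \<le> e") (auto intro: X_add)
  ultimately show ?thesis
    using adjoin_xI[of "max d e" w] by simp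
qed

lemma adjoin_x_sum:
  "(\<And>i. i \<in> A \<Longrightarrow> f i \<in> adjoin_x X) \<Longrightarrow> (\<lambda>x. \<Sum>i\<in>A. f i x) \<in> adjoin_x X"
proof (induction A rule: infinite_finite_induct)
  case (insert i A)
  then have "(\<lambda>x. f i x + (\<Sum>i\<in>A. f i x)) \<in> adjoin_x X"
    by (intro adjoin_x_add) auto
  then show ?case
    using insert.hyps by simp
qed (use X_subset_adjoin_x X_0 in auto)

lemma smooth_adjoin_x: "f \<in> adjoin_x X \<Longrightarrow> smooth f"
proof (elim adjoin_x_obtain)
  fix d :: nat and g :: "nat \<Rightarrow> real \<Rightarrow> complex"
  assume "f = (\<lambda>x. \<Sum>j\<le>d. g j x * of_real x ^ j)" "\<And>j. g j \<in> X"
  then show "smooth f"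
    by (simp only:) (intro smooth_sum smooth_mult smooth_power_of_real smooth_X)
qed

lemma adjoin_x_cmult:
  assumes "f \<in> adjoin_x X"
  shows "(\<lambda>x. c * f x) \<in> adjoin_x X"
proof -
  obtain d u where u: "f = (\<lambda>x. \<Sum>j\<le>d. u j x * of_real x ^ j)" "\<And>j. u j \<in> X"
    using adjoin_x_obtain[OF assms(1)] by metis
  have "(\<lambda>x. c * f x) = (\<lambda>x. \<Sum>j\<le>d. c * u j x * of_real x ^ j)"
    by (simp add: u(1) sum_distrib_left mult.assoc)
  then show ?thesis
    using adjoin_xI[of d "\<lambda>j x. c * u j x"] X_cmult u(2) by auto
qed

lemma adjoin_x_diff_D:
  assumes "f \<in> adjoin_x X"
  shows "diff_D f \<in> adjoin_x X"
proof -
  obtain d u where u: "f = (\<lambda>x. \<Sum>j\<le>d. u j x * of_real x ^ j)" "\<And>j. u j \<in> X"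
    using adjoin_x_obtain[OF assms(1)] by metis
  have smooth: "smooth (\<lambda>x. u j x * of_real x ^ j)" for j
    using u(2) by (intro smooth_mult smooth_X smooth_power_of_real)
  have "op_apply [:0, 1:] g x = diff_D g x" for g x
    by (simp add: op_apply_pCons)
  with op_apply_fun_sum[of "{..d}" "\<lambda>j x. u j x * of_real x ^ j" "[:0, 1:]"] smooth
  have "diff_D f = (\<lambda>x. \<Sum>j\<le>d. diff_D (\<lambda>x. u j x * of_real x ^ j) x)"
    by (simp add: u(1) fun_eq_iff)
  moreover have "diff_D (\<lambda>x. u j x * of_real x ^ j) \<in> adjoin_x X" for j
  proof -
    have "(\<lambda>x. (- \<i> * of_nat j) * u j x * of_real x ^ (j - 1)) \<in> adjoin_x X"
      by (rule adjoin_x_mult_power X_cmult u(2))+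
    moreover have "(\<lambda>x. diff_D (u j) x * of_real x ^ j) \<in> adjoin_x X"
      by (rule adjoin_x_mult_power X_diff_D u(2))+
    ultimately show ?thesis
      using adjoin_x_add u(2)[of j] by (simp only: diff_D_mult_power smooth_X)
  qed
  ultimately show ?thesis
    by (simp add: adjoin_x_sum)
qed

lemma adjoin_x_op_apply: "f \<in> adjoin_x X \<Longrightarrow> op_apply p f \<in> adjoin_x X"
proof (induction p arbitrary: f)
  case 0
  have "op_apply 0 f = (\<lambda>x. 0)"
    by (simp add: fun_eq_iff)
  then show ?case
    using X_0 X_subset_adjoin_x by auto
next
  case (pCons c p)
  have "op_apply (pCons c p) f = (\<lambda>x. c * f x + op_apply p (diff_D f) x)"
    by (simp add: op_apply_pCons fun_eq_iff)
  then show ?case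
    using pCons by (simp add: adjoin_x_add adjoin_x_cmult adjoin_x_diff_D)
qed

lemma X_op_apply: "f \<in> X \<Longrightarrow> op_apply p f \<in> X"
proof (induction p arbitrary: f)
  case 0
  have "op_apply 0 f = (\<lambda>x. 0)"
    by (simp add: fun_eq_iff)
  then show ?case
    using X_0 by auto
next
  case (pCons c p)
  have "op_apply (pCons c p) f = (\<lambda>x. c * f x + op_apply p (diff_D f) x)"
    by (simp add: op_apply_pCons fun_eq_iff)
  then show ?case
    using pCons by (simp add: X_add X_cmult X_diff_D)
qed

lemma adjoin_x_act: "(\<And>j. f $ j \<in> adjoin_x X) \<Longrightarrow> act r f \<in> adjoin_x X"
  unfolding act_def by (intro adjoin_x_sum adjoin_x_op_apply)

lemma X_act:
  assumes "\<And>j. f $ j \<in> X"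
  shows "act r f \<in> X"
proof -
  have "(\<lambda>x. \<Sum>i\<in>A. op_apply (r $ i) (f $ i) x) \<in> X" for A
  proof (induction A rule: infinite_finite_induct)
    case (insert i A)
    then have "(\<lambda>x. op_apply (r $ i) (f $ i) x + (\<Sum>i\<in>A. op_apply (r $ i) (f $ i) x)) \<in> X"
      by (intro X_add X_op_apply assms)
    then show ?case
      using insert.hyps by simp
  qed (use X_0 in auto)
  then show ?thesis
    by (simp add: act_def)
qed

text \<open>The source of the injectivity results below: by \<open>linear_kernel\<close>, a nonzero
  signal killed by D - a is such an exponential.\<close>

lemma exp_in_adjoin_x:
  assumes "exp_poly a [:c:] \<in> adjoin_x X" and "c \<noteq> 0"
  shows "a \<in> \<Lambda>"
proof -
  obtain d u where u: "exp_poly a [:c:] = (\<lambda>x. \<Sum>j\<le>d. u j x * of_real x ^ j)" "\<And>j. u j \<in> X"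
    using adjoin_x_obtain[OF assms(1)] by metis
  obtain N where N: "N \<in> P" "\<forall>f\<in>u ` {..d}. has_period N f"
    using common_period[of "u ` {..d}"] u(2) by auto
  define w where "w = exp (2 * pi * real N * (\<i> * a))"
  \<comment> \<open>At the points 2 pi N t every coefficient \<open>u j\<close> has its value at 0,
    so t enters only through the powers of x.\<close>
  define R where "R = (\<Sum>j\<le>d. monom (u j 0 * of_real (2 * pi * real N) ^ j) j)"
  have "poly R (of_nat t) = c * w ^ t" for t
  proof -
    have period: "u j (2 * pi * real N * real t) = u j 0" if "j \<le> d" for j
    proof -
      have "\<forall>x. \<forall>k::int. u j (x + 2 * pi * real N * of_int k) = u j x"
        using N(2) that by (auto simp: has_period_def)
      from this[rule_format, of 0 "int t"] show ?thesis
        by simp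
    qed
    have "c * w ^ t = exp_poly a [:c:] (2 * pi * real N * real t)"
      by (simp add: exp_poly_def w_def mult_ac flip: exp_of_nat_mult)
    also have "\<dots> = (\<Sum>j\<le>d. u j 0 * of_real (2 * pi * real N * real t) ^ j)"
      by (simp add: u(1) period del: of_real_mult)
    also have "\<dots> = poly R (of_nat t)"
      by (simp add: R_def poly_sum poly_monom power_mult_distrib mult_ac)
    finally show ?thesis
      by simp
  qed
  then have "w = 1"
    using geometric_eq_polynomial assms(2) by blast
  \<comment> \<open>\<open>w = 1\<close> says that 2 pi N i a is an integral multiple of 2 pi i,
    that is, N a is an integer.\<close>
  then obtain m :: int where "Re (2 * pi * real N * (\<i> * a)) = 0"
      "Im (2 * pi * real N * (\<i> * a)) = of_int (2 * m) * pi"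
    by (auto simp: w_def exp_eq_1)
  then have "of_nat N * a = of_int m"
    using pos[OF N(1)] by (auto simp: complex_eq_iff)
  then show ?thesis
    using N(1) by (auto simp: frequencies_def intro!: bexI[of _ N])
qed

lemma linear_injective:
  assumes "f \<in> adjoin_x X" "\<And>x. op_apply [:- a, 1:] f x = 0" "a \<notin> \<Lambda>"
  shows "f x = 0"
proof -
  obtain c where "f = exp_poly a [:c:]"
    using linear_kernel[OF smooth_adjoin_x] assms(1,2) by blast
  then show ?thesis
    using exp_in_adjoin_x[of a c] assms(1,3) by (cases "c = 0") (auto simp: exp_poly_def)
qed

text \<open>Over the complex numbers \<open>L\<close> splits into factors D - z with z outside
  \<Lambda>, and these are peeled off by \<open>linear_injective\<close>.\<close>

lemma op_injective:
  assumes "\<forall>z\<in>\<Lambda>. poly L z \<noteq> 0" "f \<in> adjoin_x X" "\<And>x. op_apply L f x = 0"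
  shows "f x = 0"
  using assms
proof (induction "degree L" arbitrary: L x)
  case 0
  then obtain c where L: "L = [:c:]"
    by (metis degree_eq_zeroE)
  \<comment> \<open>A point of \<Lambda> is what excludes \<open>L = 0\<close>.\<close>
  have "0 \<in> \<Lambda>"
    using Ints_subset by auto
  with L 0 have "c \<noteq> 0"
    by auto
  then show ?case
    using "0.prems"(3)[of x] L by simp
next
  case (Suc n)
  then have "\<not> constant (poly L)"
    by (simp add: constant_degree)
  then obtain z where z: "poly L z = 0"
    using fundamental_theorem_of_algebra by blast
  then obtain L' where L': "L = [:- z, 1:] * L'"
    by (auto simp: poly_eq_0_iff_dvd elim: dvdE)
  have "L' \<noteq> 0"
    using Suc.hyps(2) L' by auto
  then have "degree L = Suc (degree L')"
    unfolding L' by (subst degree_mult_eq) auto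
  then have "degree L' = n"
    using Suc.hyps(2) by simp
  have "op_apply L' f y = 0" for y
  proof (rule linear_injective)
    show "op_apply L' f \<in> adjoin_x X"
      using Suc.prems by (intro adjoin_x_op_apply)
    show "z \<notin> \<Lambda>"
      using Suc.prems z by auto
    show "op_apply [:- z, 1:] (op_apply L' f) x = 0" for x
      using Suc.prems(3)[of x] op_apply_mult[OF smooth_adjoin_x[OF Suc.prems(2)], of "[:- z, 1:]" L'] L'
      by simp
  qed
  moreover have "\<forall>z\<in>\<Lambda>. poly L' z \<noteq> 0"
    using Suc.prems L' by auto
  ultimately show ?case
    using Suc.hyps(1)[of L'] \<open>degree L' = n\<close> Suc.prems(2) by blast
qed

lemma linear_square_kernel:
  assumes "f \<in> X" "a \<in> \<Lambda>" "\<And>x. op_apply [:- a, 1:] (op_apply [:- a, 1:] f) x = 0"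
  shows "op_apply [:- a, 1:] f x = 0"
proof -
  obtain c where c: "op_apply [:- a, 1:] f = exp_poly a [:c:]"
    using linear_kernel[OF smooth_op_apply[OF smooth_X]] assms by metis
  \<comment> \<open>A particular solution of (D - a) g = c exp(i a x): the factor
    \<open>\<i>\<close> cancels the \<open>- \<i>\<close> from differentiation. So f - g is a pure
    exponential and f = (b + i c x) exp(i a x).\<close>
  define g where "g = exp_poly a [:0, \<i> * c:]"
  define h where "h = (\<lambda>x. f x + (-1) * g x)"
  have g: "smooth g" "op_apply [:- a, 1:] g = exp_poly a [:c:]"
    by (simp_all add: g_def smooth_exp_poly op_apply_linear_exp_poly pderiv_pCons mult_ac)
  have "smooth h"
    unfolding h_def using g(1) smooth_X[OF assms(1)] by (intro smooth_add smooth_cmult)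
  moreover have "op_apply [:- a, 1:] h x = 0" for x
    unfolding h_def using g assms(1) c
    by (simp only: op_apply_fun_add op_apply_fun_cmult smooth_cmult smooth_X) simp
  ultimately obtain b where b: "h = exp_poly a [:b:]"
    using linear_kernel by blast
  have f: "f x = (b + \<i> * c * of_real x) * exp (\<i> * a * of_real x)" for x
    using fun_cong[OF b, of x] by (simp add: h_def g_def exp_poly_def algebra_simps)
  obtain N where N: "N \<in> P" "has_period N f" "has_period N (exp_poly a [:1:])"
    using common_period[of "{f, exp_poly a [:1:]}"] exp_in_X[OF assms(2)] assms(1) by auto
  define T where "T = 2 * pi * real N"
  have "f T = f 0" "exp_poly a [:1:] T = exp_poly a [:1:] 0"
    using N(2,3)[unfolded has_period_def, rule_format, of 0 1] by (simp_all add: T_def)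
  \<comment> \<open>The exponential takes the same value at 0 and \<open>T\<close>, so f(T) = f(0)
    compares the affine factors alone: periodicity rules out a Jordan block of size 2.\<close>
  then have "\<i> * c * of_real T = 0"
    by (simp add: f exp_poly_def)
  then have "c = 0"
    using pos[OF N(1)] by (simp add: T_def)
  then show ?thesis
    by (simp add: c exp_poly_def)
qed

text \<open>The exponent comes down one at a time, by \<open>linear_square_kernel\<close> applied to
  a lower power of D - a acting on \<open>f\<close>.\<close>

lemma linear_power_kernel:
  assumes "f \<in> X" "a \<in> \<Lambda>" "n \<ge> 1" "\<And>x. op_apply ([:- a, 1:] ^ n) f x = 0"
  shows "op_apply [:- a, 1:] f x = 0"
  using assms(3,4)
proof (induction n arbitrary: x rule: nat_induct_at_least)
  case base
  then show ?case
    by simp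
next
  case (Suc n)
  let ?g = "op_apply ([:- a, 1:] ^ (n - 1)) f"
  obtain m where m: "n = Suc m"
    using Suc.hyps by (cases n) auto
  have "?g \<in> X"
    using assms(1) by (rule X_op_apply)
  moreover have "op_apply [:- a, 1:] (op_apply [:- a, 1:] ?g) x = 0" for x
    using Suc.prems[of x] assms(1)
    by (simp only: m power_Suc op_apply_mult smooth_X smooth_op_apply) simp
  ultimately have "op_apply [:- a, 1:] ?g x = 0" for x
    using assms(2) linear_square_kernel by blast
  then have "op_apply ([:- a, 1:] ^ n) f x = 0" for x
    using assms(1) by (simp only: m power_Suc op_apply_mult smooth_X) simp
  then show ?case
    by (rule Suc.IH)
qed

end

section \<open>Injective envelopes\<close>

lemma DD_simps [simp]:
  "carrier DD = UNIV" "mult DD = (*)" "one DD = 1" "zero DD = 0" "add DD = (+)"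
  by (simp_all add: DD_def)

lemma signal_module_simps [simp]:
  "carrier (signal_module F) = F" "zero (signal_module F) = (\<lambda>x. 0)"
  "add (signal_module F) = (\<lambda>f g x. f x + g x)" "module.smult (signal_module F) = op_apply"
  by (simp_all add: signal_module_def)

lemma cring_DD: "cring DD"
proof (rule cringI)
  show "abelian_group DD"
    by (rule abelian_groupI) (auto simp: add.assoc add.commute intro: exI[of _ "- x" for x] add.left_inverse)
  show "comm_monoid DD"
    by (rule comm_monoidI) (auto simp: mult.assoc mult.commute)
qed (auto simp: algebra_simps)

lemma real_poly_eqD:
  fixes p q :: "complex poly"
  assumes "\<And>x::real. poly p (of_real x) = poly q (of_real x)"
  shows "p = q"
proof -
  have "range complex_of_real \<subseteq> {z. poly (p - q) z = 0}"
    using assms by auto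
  moreover have "infinite (range complex_of_real)"
    using infinite_UNIV_char_0 finite_imageD inj_of_real by blast
  ultimately have "p - q = 0"
    using poly_roots_finite finite_subset by blast
  then show ?thesis
    by simp
qed

text \<open>The test module consists of all functions on the real line, with a polynomial operator acting
  as multiplication by its values. It contains a free module of rank one, so injectivity yields
  divisibility.\<close>

lemma injective_imp_divisible:
  assumes inj: "injective_module TYPE(real \<Rightarrow> complex) DD (signal_module F)"
    and smooth: "\<And>f. f \<in> F \<Longrightarrow> smooth f"
    and closed: "\<And>f p. f \<in> F \<Longrightarrow> op_apply p f \<in> F"
    and "f \<in> F" "p \<noteq> 0"
  obtains u where "u \<in> F" "op_apply p u = f"
proof -
  \<comment> \<open>The test modules have elements of type
    \<open>real \<Rightarrow> complex\<close>, so polynomials are re-encoded as the functions they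
    define on the real line.\<close>
  define \<iota> where "\<iota> = (\<lambda>(q::complex poly) (x::real). poly q (of_real x))"
  define B :: "(complex poly, real \<Rightarrow> complex) module" where
    "B = \<lparr>carrier = UNIV, mult = undefined, one = undefined, zero = (\<lambda>x. 0),
      add = (\<lambda>f g x. f x + g x), smult = (\<lambda>r f x. \<iota> r x * f x)\<rparr>"
  have B_simps [simp]: "carrier B = UNIV" "zero B = (\<lambda>x. 0)" "add B = (\<lambda>f g x. f x + g x)"
    "module.smult B = (\<lambda>r f x. \<iota> r x * f x)"
    by (simp_all add: B_def)
  have \<iota>: "\<iota> (q + r) = (\<lambda>x. \<iota> q x + \<iota> r x)" "\<iota> (q * r) = (\<lambda>x. \<iota> q x * \<iota> r x)"
    "\<iota> 1 = (\<lambda>x. 1)" "\<iota> 0 = (\<lambda>x. 0)" for q r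
    by (simp_all add: \<iota>_def)
  have "inj \<iota>"
    by (intro injI real_poly_eqD) (simp add: \<iota>_def fun_eq_iff)
  have "abelian_group B"
  proof (rule abelian_groupI)
    show "\<exists>y\<in>carrier B. y \<oplus>\<^bsub>B\<^esub> x = \<zero>\<^bsub>B\<^esub>" for x
      by (intro bexI[of _ "\<lambda>t. - x t"]) simp_all
  qed (simp_all add: fun_eq_iff)
  then have B: "Module.module DD B"
    by (intro moduleI cring_DD) (simp_all add: \<iota> algebra_simps)
  define A where "A = range (\<lambda>q. \<iota> (p * q))"
  have A: "submodule A DD B"
  proof (rule module.submoduleI[OF B])
    fix u v assume "u \<in> A" "v \<in> A"
    then obtain q r where "u = \<iota> (p * q)" "v = \<iota> (p * r)"
      by (auto simp: A_def)
    then have "u \<oplus>\<^bsub>B\<^esub> v = \<iota> (p * (q + r))"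
      by (simp only: B_simps \<iota> ring_distribs)
    then show "u \<oplus>\<^bsub>B\<^esub> v \<in> A"
      by (simp add: A_def)
  next
    fix u assume "u \<in> A"
    then obtain q where q: "u = \<iota> (p * q)"
      by (auto simp: A_def)
    have "\<ominus>\<^bsub>B\<^esub> u = \<iota> (p * (- q))"
    proof (rule abelian_group.minus_equality[OF \<open>abelian_group B\<close>])
      show "\<iota> (p * - q) \<oplus>\<^bsub>B\<^esub> u = \<zero>\<^bsub>B\<^esub>"
        by (simp add: q \<iota>_def)
    qed simp_all
    then show "\<ominus>\<^bsub>B\<^esub> u \<in> A"
      unfolding A_def by blast
  next
    fix r u assume "u \<in> A"
    then obtain q where "u = \<iota> (p * q)"
      by (auto simp: A_def)
    then have "r \<odot>\<^bsub>B\<^esub> u = \<iota> (p * (r * q))"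
      by (simp add: \<iota> mult_ac)
    then show "r \<odot>\<^bsub>B\<^esub> u \<in> A"
      by (simp add: A_def)
  next
    have "\<iota> (p * 0) \<in> A"
      unfolding A_def by blast
    then show "\<zero>\<^bsub>B\<^esub> \<in> A"
      by (simp add: \<iota>)
  qed simp
  \<comment> \<open>On the ideal generated by \<open>p\<close> this is the map sending p q to q f,
    well defined as \<open>p\<close> is nonzero. An extension g to \<open>B\<close> then gives p
    g(1) = g(p) = f.\<close>
  define h where "h = (\<lambda>u. op_apply (inv_into UNIV \<iota> u div p) f)"
  have h: "h (\<iota> (p * q)) = op_apply q f" for q
    using \<open>p \<noteq> 0\<close> by (simp add: h_def inv_f_f[OF \<open>inj \<iota>\<close>])
  have "h \<in> mod_hom DD (B\<lparr>carrier := A\<rparr>) (signal_module F)"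
    unfolding mod_hom_def
  proof (intro CollectI conjI ballI)
    show "h \<in> carrier (B\<lparr>carrier := A\<rparr>) \<rightarrow> carrier (signal_module F)"
      using h closed[OF \<open>f \<in> F\<close>] by (auto simp: A_def)
  next
    fix u v assume "u \<in> carrier (B\<lparr>carrier := A\<rparr>)" "v \<in> carrier (B\<lparr>carrier := A\<rparr>)"
    then obtain q r where qr: "u = \<iota> (p * q)" "v = \<iota> (p * r)"
      by (auto simp: A_def)
    then have "u \<oplus>\<^bsub>B\<lparr>carrier := A\<rparr>\<^esub> v = \<iota> (p * (q + r))"
      by (simp add: \<iota> ring_distribs)
    then show "h (u \<oplus>\<^bsub>B\<lparr>carrier := A\<rparr>\<^esub> v) = h u \<oplus>\<^bsub>signal_module F\<^esub> h v"
      by (simp only: h qr) (simp add: op_apply_add fun_eq_iff)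
  next
    fix r u assume "u \<in> carrier (B\<lparr>carrier := A\<rparr>)"
    then obtain q where q: "u = \<iota> (p * q)"
      by (auto simp: A_def)
    then have "r \<odot>\<^bsub>B\<lparr>carrier := A\<rparr>\<^esub> u = \<iota> (p * (r * q))"
      by (simp add: \<iota> mult_ac)
    then show "h (r \<odot>\<^bsub>B\<lparr>carrier := A\<rparr>\<^esub> u) = r \<odot>\<^bsub>signal_module F\<^esub> h u"
      by (simp only: h q) (simp add: op_apply_mult smooth \<open>f \<in> F\<close>)
  qed
  then obtain g where g: "g \<in> mod_hom DD B (signal_module F)" "\<And>x. x \<in> A \<Longrightarrow> g x = h x"
    using inj A B unfolding injective_module_def by blast
  have "op_apply p (g (\<iota> 1)) = g (p \<odot>\<^bsub>B\<^esub> \<iota> 1)"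
    using g(1) by (auto simp: mod_hom_def)
  also have "p \<odot>\<^bsub>B\<^esub> \<iota> 1 = \<iota> (p * 1)"
    by (simp add: \<iota>)
  also have "g (\<iota> (p * 1)) = f"
    using g(2)[of "\<iota> (p * 1)"] unfolding h A_def by (metis op_apply_1 rangeI)
  finally have "op_apply p (g (\<iota> 1)) = f" .
  moreover have "g (\<iota> 1) \<in> F"
    using g(1) by (auto simp: mod_hom_def)
  ultimately show ?thesis
    using that by blast
qed

lemma submodule_signal_moduleD:
  assumes "submodule E DD (signal_module Y)"
  shows "E \<subseteq> Y" "f \<in> E \<Longrightarrow> g \<in> E \<Longrightarrow> (\<lambda>x. f x + g x) \<in> E" "f \<in> E \<Longrightarrow> op_apply p f \<in> E"
  using subgroup.subset[OF submodule.axioms(1)[OF assms]]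
    subgroup.m_closed[OF submodule.axioms(1)[OF assms]] submodule.smult_closed[OF assms]
  by auto

context period_set
begin

lemma injective_envelope_subset: "injective_envelope_in X (adjoin_x X) F \<Longrightarrow> F \<subseteq> adjoin_x X"
  unfolding injective_envelope_in_def using submodule_signal_moduleD(1) by blast

text \<open>The envelope is given only by its properties, so its elements are produced by division:
  some u in \<open>F\<close> has the same image under D - a as the wanted function, and the
  difference is a multiple of exp(i a x), which lies in \<open>X\<close>. The induction works
  because D - a lowers the degree.\<close>

lemma exp_poly_in_injective_envelope:
  assumes "injective_envelope_in X (adjoin_x X) F" and "a \<in> \<Lambda>"
  shows "exp_poly a Q \<in> F"
proof -
  have sub: "submodule F DD (signal_module (adjoin_x X))"
    and inj: "injective_module TYPE(real \<Rightarrow> complex) DD (signal_module F)"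
    and "X \<subseteq> F"
    using assms(1) submodule_signal_moduleD(1)
    by (auto simp: injective_envelope_in_def essential_submodule_def)
  note closed = submodule_signal_moduleD[OF sub]
  have smooth: "smooth f" if "f \<in> F" for f
    using that closed(1) smooth_adjoin_x by blast
  show ?thesis
  proof (induction "degree Q" arbitrary: Q rule: less_induct)
    case less
    show ?case
    proof (cases "degree Q = 0")
      case True
      then show ?thesis
        using exp_in_X[OF assms(2)] \<open>X \<subseteq> F\<close> by (metis degree_eq_zeroE subsetD)
    next
      case False
      have "degree ([:- \<i>:] * pderiv Q) < degree Q"
        using False by (simp add: degree_pderiv)
      then have "exp_poly a ([:- \<i>:] * pderiv Q) \<in> F"
        by (rule less)
      moreover have "[:- a, 1:] \<noteq> 0"
        by simp
      ultimately obtain u where u: "u \<in> F" "op_apply [:- a, 1:] u = exp_poly a ([:- \<i>:] * pderiv Q)"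
        using injective_imp_divisible[OF inj smooth closed(3)] by blast
      define v where "v = (\<lambda>x. exp_poly a Q x + (- 1) * u x)"
      have "smooth v"
        unfolding v_def by (intro smooth_add smooth_cmult smooth_exp_poly smooth u(1))
      moreover have "op_apply [:- a, 1:] v x = 0" for x
        unfolding v_def using smooth[OF u(1)]
        by (simp only: op_apply_fun_add op_apply_fun_cmult smooth_cmult smooth_exp_poly
            op_apply_linear_exp_poly u(2)) simp
      ultimately obtain c where c: "v = exp_poly a [:c:]"
        using linear_kernel by blast
      have "exp_poly a Q = (\<lambda>x. exp_poly a [:c:] x + u x)"
        by (simp add: c[symmetric] v_def)
      then show ?thesis
        using closed(2)[OF _ u(1)] exp_in_X[OF assms(2)] \<open>X \<subseteq> F\<close> by auto
    qed
  qed
qed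

lemma explicit_envelope_subset: "explicit_envelope X W \<subseteq> adjoin_x X"
  by (auto simp: explicit_envelope_def adjoin_x_def)

lemma exp_poly_in_explicit_envelope:
  assumes "complex_of_real w \<in> \<Lambda>" and "w \<in> W"
  shows "exp_poly (of_real w) Q \<in> explicit_envelope X W"
proof -
  define f where "f = (\<lambda>j. exp_poly (of_real w) [:coeff Q j:])"
  have "f j \<in> X" for j
    unfolding f_def by (rule exp_in_X[OF assms(1)])
  moreover have "finite_fourier (f j) W" for j
    unfolding finite_fourier_def f_def exp_poly_def
    by (rule exI[of _ "{w}"], rule exI[of _ "\<lambda>_. coeff Q j"]) (use assms in \<open>simp add: mult_ac\<close>)
  moreover have "exp_poly (of_real w) Q = (\<lambda>x. \<Sum>j\<le>degree Q. f j x * of_real x ^ j)"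
    by (simp add: f_def exp_poly_def fun_eq_iff poly_altdef sum_distrib_left sum_distrib_right mult_ac)
  ultimately show ?thesis
    unfolding explicit_envelope_def by blast
qed

lemma frequencies_real:
  assumes "a \<in> \<Lambda>"
  shows "a \<in> range complex_of_real"
proof -
  obtain N m where N: "N \<in> P" "of_nat N * a = of_int m"
    using assms by (auto simp: frequencies_def elim!: Ints_cases)
  then have "a = of_real (of_int m / of_nat N)"
    using pos[OF N(1)] by (simp add: field_simps)
  then show ?thesis
    by blast
qed

lemma exp_poly_in_adjoin_x:
  assumes "a \<in> \<Lambda>"
  shows "exp_poly a Q \<in> adjoin_x X"
proof -
  obtain w where "a = complex_of_real w"
    using frequencies_real[OF assms] by blast
  then show ?thesis
    using exp_poly_in_explicit_envelope[of w UNIV] explicit_envelope_subset assms by blast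
qed

end

section \<open>Signals outside the annihilator\<close>

text \<open>Prescribe 1 on \<open>r\<close> and 0 on a maximal independent subset of
  \<open>W\<close>. The lemma serves over the complex numbers, where the operators form a space of
  infinite dimension, and over the field of fractions.\<close>

lemma (in vector_space) separating_functional:
  assumes "r \<notin> span W"
  obtains l where "Vector_Spaces.linear scale (*) l" "\<And>x. x \<in> W \<Longrightarrow> l x = 0" "l r = 1"
proof -
  interpret vector_space_pair scale "(*)"
    by unfold_locales (auto simp: algebra_simps)
  obtain B where B: "B \<subseteq> W" "independent B" "W \<subseteq> span B"
    by (rule maximal_independent_subset)
  have "r \<notin> span B"
    using assms B(1) span_mono by blast
  then have "independent (insert r B)"
    using B(2) independent_insertI by blast
  then obtain l where l: "Vector_Spaces.linear scale (*) l"
      "\<forall>x\<in>insert r B. l x = (if x = r then 1 else 0)"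
    using linear_independent_extend[of "insert r B" "\<lambda>x. if x = r then 1 else 0"] by blast
  have "l x = 0" if "x \<in> B" for x
    using l(2) that \<open>r \<notin> span B\<close> span_base by auto
  then have "l x = 0" if "x \<in> W" for x
    using linear_eq_0_on_span[OF l(1)] B(3) that by blast
  then show ?thesis
    using that l by auto
qed

lemma sum_axis: "(\<Sum>j\<in>UNIV. (r $ j) *s axis j 1) = r" for r :: "('a::comm_ring_1) ^ 'q::finite"
  by (simp add: vec_eq_iff axis_def if_distrib[of "\<lambda>z. _ * z"] cong: if_cong)

locale operator_submodule =
  fixes M :: "(complex poly ^ 'q::finite) set"
  assumes zero_mem: "0 \<in> M"
    and add_mem: "r \<in> M \<Longrightarrow> s \<in> M \<Longrightarrow> r + s \<in> M"
    and smult_mem: "r \<in> M \<Longrightarrow> p *s r \<in> M"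
begin

lemma diff_mem: "r \<in> M \<Longrightarrow> s \<in> M \<Longrightarrow> r - s \<in> M"
proof -
  assume "r \<in> M" "s \<in> M"
  then have "r + (- 1) *s s \<in> M"
    by (intro add_mem smult_mem)
  also have "r + (- 1) *s s = r - s"
    by (simp add: vec_eq_iff)
  finally show ?thesis .
qed

lemma sum_mem: "(\<And>i. i \<in> A \<Longrightarrow> r i \<in> M) \<Longrightarrow> (\<Sum>i\<in>A. r i) \<in> M"
  by (induction A rule: infinite_finite_induct) (auto simp: zero_mem add_mem)

text \<open>A complex-linear functional on operators that vanishes on \<open>M\<close> and on all multiples of
  \<open>(D - a)\<^sup>m\<close> is \<open>r \<mapsto> (r f)(0)\<close> for a tuple \<open>f\<close> of exponential polynomials of frequency
  \<open>a\<close>, and \<open>f\<close> then lies in the behavior.\<close>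

lemma willems_closure_localized:
  assumes F: "\<And>Q. degree Q < m \<Longrightarrow> exp_poly a Q \<in> F" and "m \<ge> 1"
    and r: "r \<in> willems_closure F M"
  obtains s where "r - [:- a, 1:] ^ m *s s \<in> M"
proof (rule ccontr)
  assume contra: "\<not> thesis"
  define scale where "scale = (\<lambda>(c::complex) (v :: complex poly ^ 'q). [:c:] *s v)"
  interpret vs: vector_space scale
    by unfold_locales
      (simp_all add: scale_def vec_eq_iff algebra_simps smult_add_right smult_add_left)
  let ?d = "[:- a, 1:]"
  define W where "W = {v + ?d ^ m *s s | v s. v \<in> M}"
  have W_add: "v + w \<in> W" if "v \<in> W" "w \<in> W" for v w
  proof -
    from that obtain v' s w' t
      where "v = v' + ?d ^ m *s s" "w = w' + ?d ^ m *s t" "v' \<in> M" "w' \<in> M"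
      unfolding W_def by blast
    then have "v + w = (v' + w') + ?d ^ m *s (s + t)" "v' + w' \<in> M"
      by (simp_all add: vec.scale_right_distrib vec_eq_iff algebra_simps add_mem)
    then show ?thesis
      unfolding W_def by blast
  qed
  have W_smult: "p *s v \<in> W" if "v \<in> W" for p v
  proof -
    from that obtain v' s where "v = v' + ?d ^ m *s s" "v' \<in> M"
      unfolding W_def by blast
    then have "p *s v = p *s v' + ?d ^ m *s (p *s s)" "p *s v' \<in> M"
      by (simp_all add: vec_eq_iff algebra_simps smult_mem)
    then show ?thesis
      unfolding W_def by blast
  qed
  have M_W: "M \<subseteq> W"
  proof
    fix v assume "v \<in> M"
    moreover have "v = v + ?d ^ m *s 0"
      by simp
    ultimately show "v \<in> W"
      unfolding W_def by blast
  qed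
  have power_W: "?d ^ m *s v \<in> W" for v
    using zero_mem unfolding W_def by force
  have "vs.subspace W"
    by (rule vs.subspaceI) (use M_W zero_mem W_add W_smult in \<open>auto simp: scale_def\<close>)
  moreover have "r \<notin> W"
  proof
    assume "r \<in> W"
    then obtain v s where "v \<in> M" "r = v + ?d ^ m *s s"
      unfolding W_def by blast
    then have "r - ?d ^ m *s s \<in> M"
      by simp
    then show False
      using contra that by blast
  qed
  ultimately have "r \<notin> vs.span W"
    by (metis vs.span_eq_iff)
  then obtain l where l: "Vector_Spaces.linear scale (*) l" "\<And>x. x \<in> W \<Longrightarrow> l x = 0" "l r = 1"
    using vs.separating_functional by blast
  have l_add: "l (v + w) = l v + l w" and l_scale: "l ([:c:] *s v) = c * l v" for v w c
    using Vector_Spaces.linear.axioms(3)[OF l(1)] by (simp_all add: module_hom_iff scale_def)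
  have l_0: "l 0 = 0"
    using l(2) M_W zero_mem by auto
  have l_sum: "l (\<Sum>j\<in>A. v j) = (\<Sum>j\<in>A. l (v j))" for A :: "'q set" and v
    by (induction A rule: infinite_finite_induct) (simp_all add: l_0 l_add)
  \<comment> \<open>The coefficients are solved for so that \<open>base\<close> holds: the power of
    \<open>\<i>\<close> and the factorial undo the constants in
    \<open>op_apply_linear_power_exp_poly_0\<close>. For k >= m both sides of \<open>base\<close>
    vanish.\<close>
  define Q where "Q = (\<lambda>j. \<Sum>k<m. monom (\<i> ^ k * l (?d ^ k *s axis j 1) / fact k) k)"
  define f where "f = (\<chi> j. exp_poly a (Q j))"
  have f_F: "f $ j \<in> F" for j
  proof -
    have "degree (Q j) \<le> m - 1"
      unfolding Q_def
      by (intro degree_sum_le) (auto intro: order.trans[OF degree_monom_le])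
    then show ?thesis
      using F[of "Q j"] \<open>m \<ge> 1\<close> by (simp add: f_def)
  qed
  have smooth_f: "smooth (f $ j)" for j
    by (simp add: f_def smooth_exp_poly)
  have base: "op_apply (?d ^ k) (f $ j) 0 = l (?d ^ k *s axis j 1)" for j k
  proof (cases "k < m")
    case True
    have "coeff (Q j) k = \<i> ^ k * l (?d ^ k *s axis j 1) / fact k"
      using True by (simp add: Q_def coeff_sum sum.delta if_distrib cong: if_cong)
    moreover have "(- \<i>) ^ k * \<i> ^ k = 1"
      by (simp flip: power_mult_distrib)
    ultimately show ?thesis
      by (simp add: f_def op_apply_linear_power_exp_poly_0 mult.assoc[symmetric])
  next
    case False
    then have "?d ^ k *s axis j 1 = ?d ^ m *s (?d ^ (k - m) *s axis j 1)"
      by (simp add: vec.scale_scale vector_smult_assoc flip: power_add)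
    then have "l (?d ^ k *s axis j 1) = 0"
      using l(2) power_W by metis
    moreover have "coeff (Q j) k = 0"
      using False by (auto simp: Q_def coeff_sum intro!: sum.neutral)
    ultimately show ?thesis
      by (simp add: f_def op_apply_linear_power_exp_poly_0)
  qed
  \<comment> \<open>Agreement on the powers of D - a extends to all operators through their
    expansion in these powers. The additional exponent \<open>k\<close> is carried along because
    each Horner step raises it.\<close>
  have shifted: "op_apply (?d ^ k * pcompose p ?d) (f $ j) 0 = l ((?d ^ k * pcompose p ?d) *s axis j 1)"
    for p k j
  proof (induction p arbitrary: k)
    case 0
    then show ?case
      by (simp add: l_0)
  next
    case (pCons c p)
    have eq: "?d ^ k * pcompose (pCons c p) ?d = [:c:] * ?d ^ k + ?d ^ Suc k * pcompose p ?d"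
      by (simp add: pcompose_pCons algebra_simps)
    have "op_apply ([:c:] * ?d ^ k) (f $ j) 0 = c * l (?d ^ k *s axis j 1)"
      using smooth_f by (simp only: op_apply_mult op_apply_const base)
    moreover have "([:c:] * ?d ^ k) *s axis j 1 = [:c:] *s (?d ^ k *s axis j 1)"
      by (simp only: vector_smult_assoc)
    ultimately show ?case
      unfolding eq by (simp only: op_apply_add pCons.IH vector_sadd_rdistrib l_add l_scale)
  qed
  have comp: "op_apply p (f $ j) 0 = l (p *s axis j 1)" for p j
    using shifted[of 0 "pcompose p [:a, 1:]" j]
    by (simp add: pcompose_assoc[symmetric] pcompose_pCons)
  have act_0: "act v f 0 = l v" for v
    by (subst (2) sum_axis[symmetric]) (simp add: act_def comp l_sum)
  \<comment> \<open>The functional only controls values at 0. But \<open>act v f\<close> is again an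
    exponential polynomial and \<open>M\<close> is stable under D - a, so the values at 0 of all
    powers of D - a on it vanish, and they determine it.\<close>
  have "act v f x = 0" if "v \<in> M" for v x
  proof -
    obtain R where R: "act v f = exp_poly a R"
      using act_exp_poly[of f a v] by (auto simp: f_def)
    have "coeff R k = 0" for k
    proof -
      have "op_apply (?d ^ k) (act v f) 0 = l (?d ^ k *s v)"
        using act_smult[OF smooth_f] act_0 by metis
      also have "\<dots> = 0"
        using smult_mem[OF that] M_W l(2) by blast
      finally show ?thesis
        by (simp add: R op_apply_linear_power_exp_poly_0)
    qed
    then have "R = 0"
      by (simp add: poly_eq_iff)
    then show ?thesis
      by (simp add: R exp_poly_def)
  qed
  then have "f \<in> behavior F M"
    by (simp add: in_behavior_iff f_F)
  then have "act r f 0 = 0"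
    using r by (simp add: in_willems_closure_iff)
  then show False
    by (simp add: act_0 l(3))
qed

text \<open>If \<open>r\<close> lay in the span of \<open>M\<close> over the field of fractions, a
  common denominator p would put p r into \<open>M\<close>. So a functional over that field kills
  \<open>M\<close> but not \<open>r\<close>, and clearing denominators in its values on the axis
  vectors gives \<open>b\<close>.\<close>

lemma non_torsion_separated:
  fixes r :: "complex poly ^ 'q"
  assumes "\<And>p. p \<noteq> 0 \<Longrightarrow> p *s r \<notin> M"
  shows "\<exists>b. (\<forall>v\<in>M. (\<Sum>j\<in>UNIV. v $ j * b $ j) = 0) \<and> (\<Sum>j\<in>UNIV. r $ j * b $ j) \<noteq> 0"
proof -
  define e :: "complex poly ^ 'q \<Rightarrow> complex poly fract ^ 'q" where "e v = (\<chi> j. to_fract (v $ j))" for v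
  have denominators: "\<exists>p v. p \<noteq> 0 \<and> v \<in> M \<and> to_fract p *s x = e v" if "x \<in> vec.span (e ` M)" for x
    using that
  proof (induction rule: vec.span_induct_alt)
    case base
    show ?case
      by (rule exI[of _ 1], rule exI[of _ 0]) (simp add: zero_mem e_def vec_eq_iff)
  next
    case (step c x y)
    obtain v where v: "v \<in> M" "x = e v"
      using step by auto
    obtain p w where w: "p \<noteq> 0" "w \<in> M" "to_fract p *s y = e w"
      using step by auto
    obtain n d where nd: "c = Fract n d" "d \<noteq> 0"
      by (rule Fract_cases)
    then have c: "to_fract d * c = to_fract n"
      by (simp add: to_fract_def eq_fract)
    have "to_fract (p * d) *s (c *s x + y) = to_fract p *s ((to_fract d * c) *s x) + to_fract d *s (to_fract p *s y)"
      by (simp add: vec_eq_iff algebra_simps)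
    also have "\<dots> = e ((p * n) *s v + d *s w)"
      unfolding c w(3) v(2) by (simp add: e_def vec_eq_iff algebra_simps)
    finally show ?case
      using w nd(2) add_mem smult_mem v(1) by (metis no_zero_divisors)
  qed
  have "e r \<notin> vec.span (e ` M)"
  proof
    assume "e r \<in> vec.span (e ` M)"
    then obtain p v where p: "p \<noteq> 0" "v \<in> M" "to_fract p *s e r = e v"
      using denominators by blast
    then have "to_fract ((p *s r) $ j) = to_fract (v $ j)" for j
      by (simp add: e_def vec_eq_iff)
    then have "p *s r = v"
      by (simp only: to_fract_eq_iff vec_eq_iff) simp
    then show False
      using assms p by auto
  qed
  then obtain l where l: "Vector_Spaces.linear (*s) (*) l" "\<And>x. x \<in> e ` M \<Longrightarrow> l x = 0" "l (e r) = 1"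
    using vec.separating_functional by blast
  have l_add: "l (v + w) = l v + l w" and l_scale: "l (c *s v) = c * l v" for v w c
    using Vector_Spaces.linear.axioms(3)[OF l(1)] by (simp_all add: module_hom_iff)
  have l_0: "l 0 = 0"
    using l_scale[of 0 0] by simp
  have l_sum: "l (\<Sum>j\<in>A. v j) = (\<Sum>j\<in>A. l (v j))" for A :: "'q set" and v
    by (induction A rule: infinite_finite_induct) (simp_all add: l_0 l_add)
  have l_eq: "l v = (\<Sum>j\<in>UNIV. v $ j * l (axis j 1))" for v
    by (subst sum_axis[of v, symmetric]) (simp add: l_sum l_scale)
  have "\<exists>n d. l (axis j 1) = Fract n d \<and> d \<noteq> 0" for j
    by (metis Fract_cases)
  then obtain n d where nd: "\<And>j. l (axis j 1) = Fract (n j) (d j)" "\<And>j. d j \<noteq> 0"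
    by metis
  define p where "p = (\<Prod>j\<in>UNIV. d j)"
  \<comment> \<open>The numerators over the common denominator \<open>p\<close>; pairing with
    \<open>b\<close> is therefore \<open>p\<close> times the functional \<open>l\<close>.\<close>
  define b where "b = (\<chi> j. n j * (\<Prod>i\<in>UNIV - {j}. d i))"
  have p: "p = d j * (\<Prod>i\<in>UNIV - {j}. d i)" for j
    unfolding p_def by (rule prod.remove) auto
  have b: "to_fract (b $ j) = to_fract p * l (axis j 1)" for j
    by (simp add: b_def nd p[of j] to_fract_def eq_fract nd(2) mult_ac)
  have sum_b: "to_fract (\<Sum>j\<in>UNIV. v $ j * b $ j) = to_fract p * l (e v)" for v
  proof -
    have "to_fract (\<Sum>j\<in>A. v $ j * b $ j) = (\<Sum>j\<in>A. to_fract (v $ j) * to_fract (b $ j))" for A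
      by (induction A rule: infinite_finite_induct) simp_all
    moreover have "l (e v) = (\<Sum>j\<in>UNIV. to_fract (v $ j) * l (axis j 1))"
      using l_eq[of "e v"] by (simp add: e_def)
    ultimately show ?thesis
      by (simp add: b sum_distrib_left mult_ac)
  qed
  show ?thesis
  proof (intro exI conjI ballI)
    show "(\<Sum>j\<in>UNIV. v $ j * b $ j) = 0" if "v \<in> M" for v
    proof -
      have "to_fract (\<Sum>j\<in>UNIV. v $ j * b $ j) = to_fract 0"
        using that by (simp only: sum_b l(2) imageI) simp
      then show ?thesis
        by (simp only: to_fract_eq_iff)
    qed
    have "p \<noteq> 0"
      by (simp add: p_def nd(2))
    then have "to_fract (\<Sum>j\<in>UNIV. r $ j * b $ j) \<noteq> to_fract 0"
      by (simp only: sum_b l(3)) simp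
    then show "(\<Sum>j\<in>UNIV. r $ j * b $ j) \<noteq> 0"
      by metis
  qed
qed

text \<open>For \<open>r\<close> outside the torsion, its pairing with the vector \<open>b\<close>
  of \<open>non_torsion_separated\<close> is a nonzero polynomial, so some integer \<open>a\<close>
  is not a root. The signals exp(i a x) with amplitudes \<open>poly (b $ j) a\<close> then form an
  element of the behavior that \<open>r\<close> does not kill.\<close>

lemma willems_closure_torsion:
  assumes F: "\<And>a c. a \<in> \<int> \<Longrightarrow> exp_poly a [:c:] \<in> F"
    and r: "r \<in> willems_closure F M"
  shows "\<exists>p. p \<noteq> 0 \<and> p *s r \<in> M"
proof (rule ccontr)
  assume "\<not> ?thesis"
  then have "\<And>p. p \<noteq> 0 \<Longrightarrow> p *s r \<notin> M"
    by blast
  from non_torsion_separated[OF this] obtain b where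
      b: "\<forall>v\<in>M. (\<Sum>j\<in>UNIV. v $ j * b $ j) = 0" "(\<Sum>j\<in>UNIV. r $ j * b $ j) \<noteq> 0"
    by blast
  have "infinite (range (of_nat :: nat \<Rightarrow> complex))"
    by (simp add: finite_image_iff inj_of_nat)
  then have "\<not> range of_nat \<subseteq> {z. poly (\<Sum>j\<in>UNIV. r $ j * b $ j) z = 0}"
    using poly_roots_finite[OF b(2)] finite_subset by blast
  then obtain m :: nat where "poly (\<Sum>j\<in>UNIV. r $ j * b $ j) (of_nat m) \<noteq> 0"
    by blast
  then obtain a :: complex where a: "a \<in> \<int>" "poly (\<Sum>j\<in>UNIV. r $ j * b $ j) a \<noteq> 0"
    using Ints_of_nat by blast
  define f where "f = (\<chi> j. exp_poly a [:poly (b $ j) a:])"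
  have act: "act v f x = poly (\<Sum>j\<in>UNIV. v $ j * b $ j) a * exp (\<i> * a * of_real x)" for v x
    by (simp add: act_def f_def op_apply_exp poly_sum sum_distrib_right) (simp add: exp_poly_def)
  have "f \<in> behavior F M"
    using b(1) F[OF a(1)] by (simp add: in_behavior_iff act) (simp add: f_def)
  then have "act r f 0 = 0"
    using r by (simp add: in_willems_closure_iff)
  then show False
    using a(2) by (simp add: act)
qed

end

section \<open>The Willems closure in terms of a decomposition of the torsion\<close>

text \<open>The decomposition in terms of representatives: \<open>e i\<close> lifts the generator of
  the i-th summand. The numbers \<open>a i\<close> may repeat, so conditions are imposed on single
  coefficients and not on primary components.\<close>

locale torsion_decomposition = operator_submodule M for M :: "(complex poly ^ 'q::finite) set" +
  fixes k :: nat and a :: "nat \<Rightarrow> complex" and n :: "nat \<Rightarrow> nat"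
    and e :: "nat \<Rightarrow> complex poly ^ 'q"
  assumes n_pos: "i < k \<Longrightarrow> n i \<ge> 1"
    and generator: "i < k \<Longrightarrow> [:- a i, 1:] ^ n i *s e i \<in> M"
    and independent: "(\<Sum>i<k. p i *s e i) \<in> M \<Longrightarrow> i < k \<Longrightarrow> [:- a i, 1:] ^ n i dvd p i"
    and spanning: "c \<noteq> 0 \<Longrightarrow> c *s r \<in> M \<Longrightarrow> \<exists>p. r - (\<Sum>i<k. p i *s e i) \<in> M"
begin

text \<open>Modulo \<open>M\<close>, \<open>r\<close> is \<open>[:- a i, 1:] ^ m\<close> times
  \<open>s\<close>, so \<open>s\<close> is torsion as well and has coefficients \<open>q\<close> of
  its own. By independence \<open>[:- a i, 1:] ^ n i\<close> divides the difference of
  \<open>p i\<close> and \<open>[:- a i, 1:] ^ m * q i\<close>, and m <= \<open>n i\<close>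
  concludes.\<close>

lemma dvd_coefficient:
  assumes "r - (\<Sum>i<k. p i *s e i) \<in> M" "c \<noteq> 0" "c *s r \<in> M"
    and "r - [:- a i, 1:] ^ m *s s \<in> M" "i < k" "m \<le> n i"
  shows "[:- a i, 1:] ^ m dvd p i"
proof -
  let ?d = "[:- a i, 1:] ^ m"
  have "c *s r - c *s (r - ?d *s s) \<in> M"
    by (rule diff_mem[OF assms(3) smult_mem[OF assms(4)]])
  moreover have "c *s r - c *s (r - ?d *s s) = (c * ?d) *s s"
    by (simp add: vec_eq_iff algebra_simps)
  moreover have "c * ?d \<noteq> 0"
    using assms(2) by simp
  ultimately obtain q where q: "s - (\<Sum>i<k. q i *s e i) \<in> M"
    using spanning by metis
  have "(r - ?d *s s) - (r - (\<Sum>i<k. p i *s e i)) + ?d *s (s - (\<Sum>i<k. q i *s e i)) \<in> M"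
    using assms q by (intro add_mem[OF diff_mem smult_mem])
  also have "(r - ?d *s s) - (r - (\<Sum>i<k. p i *s e i)) + ?d *s (s - (\<Sum>i<k. q i *s e i)) =
      (\<Sum>i<k. (p i - ?d * q i) *s e i)"
    by (simp add: vec_eq_iff sum_subtractf algebra_simps sum_distrib_left)
  finally have "[:- a i, 1:] ^ n i dvd p i - ?d * q i"
    by (rule independent[of "\<lambda>j. p j - ?d * q j", OF _ \<open>i < k\<close>])
  then have "?d dvd p i - ?d * q i"
    using \<open>m \<le> n i\<close> le_imp_power_dvd dvd_trans by blast
  then show ?thesis
    using dvd_diff_left_iff[of ?d "?d * q i" "p i"] by auto
qed

lemma act_decomposed:
  assumes "r - (\<Sum>i<k. p i *s e i) \<in> M" "f \<in> behavior F M" "\<And>f. f \<in> F \<Longrightarrow> smooth f"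
  shows "act r f x = (\<Sum>i<k. op_apply (p i) (act (e i) f) x)"
proof -
  have smooth: "smooth (f $ j)" for j
    using assms by (simp add: in_behavior_iff)
  have "act r f x = act (r - (\<Sum>i<k. p i *s e i)) f x + act (\<Sum>i<k. p i *s e i) f x"
    by (simp flip: act_add)
  also have "\<dots> = (\<Sum>i<k. op_apply (p i) (act (e i) f) x)"
    using assms(1,2) by (simp add: in_behavior_iff act_sum act_smult[OF smooth])
  finally show ?thesis .
qed

lemma generator_kernel:
  assumes "i < k" "f \<in> behavior F M" "\<And>f. f \<in> F \<Longrightarrow> smooth f"
  shows "op_apply ([:- a i, 1:] ^ n i) (act (e i) f) x = 0"
proof -
  have smooth: "smooth (f $ j)" for j
    using assms by (simp add: in_behavior_iff)
  show ?thesis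
    using act_smult[OF smooth, of "[:- a i, 1:] ^ n i" "e i"] generator[OF assms(1)] assms(2)
    by (metis in_behavior_iff)
qed

end

locale torsion_decomposition_periods = torsion_decomposition + period_set
begin

text \<open>At a frequency \<open>X\<close> contains the exponentials with constant amplitude, so
  localisation with m = 1 yields one factor D - \<open>a i\<close>. Conversely
  \<open>act (e i) f\<close> is killed by a power of D - \<open>a i\<close>, hence by D -
  \<open>a i\<close> itself at a frequency, and it is zero elsewhere.\<close>

lemma in_willems_closure_periodic_iff:
  "r \<in> willems_closure X M \<longleftrightarrow>
    (\<exists>p. (\<forall>i<k. a i \<in> \<Lambda> \<longrightarrow> [:- a i, 1:] dvd p i) \<and> r - (\<Sum>i<k. p i *s e i) \<in> M)"
proof
  assume r: "r \<in> willems_closure X M"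
  then obtain c where c: "c \<noteq> 0" "c *s r \<in> M"
    using willems_closure_torsion[OF exp_in_X[OF subsetD[OF Ints_subset]]] by blast
  then obtain p where p: "r - (\<Sum>i<k. p i *s e i) \<in> M"
    using spanning by blast
  have "[:- a i, 1:] dvd p i" if i: "i < k" "a i \<in> \<Lambda>" for i
  proof -
    have "exp_poly (a i) Q \<in> X" if "degree Q < 1" for Q
      using that exp_in_X[OF i(2)] by (metis degree_eq_zeroE less_one)
    then obtain s where "r - [:- a i, 1:] ^ 1 *s s \<in> M"
      using willems_closure_localized[of 1 "a i" X r] r by blast
    then show ?thesis
      using dvd_coefficient[OF p c _ i(1)] n_pos[OF i(1)] by (metis power_one_right)
  qed
  with p show "\<exists>p. (\<forall>i<k. a i \<in> \<Lambda> \<longrightarrow> [:- a i, 1:] dvd p i) \<and> r - (\<Sum>i<k. p i *s e i) \<in> M"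
    by blast
next
  assume "\<exists>p. (\<forall>i<k. a i \<in> \<Lambda> \<longrightarrow> [:- a i, 1:] dvd p i) \<and> r - (\<Sum>i<k. p i *s e i) \<in> M"
  then obtain p where p: "\<And>i. i < k \<Longrightarrow> a i \<in> \<Lambda> \<Longrightarrow> [:- a i, 1:] dvd p i"
      "r - (\<Sum>i<k. p i *s e i) \<in> M"
    by blast
  show "r \<in> willems_closure X M"
    unfolding in_willems_closure_iff
  proof (intro ballI allI)
    fix f x assume f: "f \<in> behavior X M"
    have "op_apply (p i) (act (e i) f) x = 0" if i: "i < k" for i
    proof -
      let ?g = "act (e i) f"
      have g: "?g \<in> X"
        using f by (intro X_act) (simp add: in_behavior_iff)
      have ker: "op_apply ([:- a i, 1:] ^ n i) ?g x = 0" for x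
        using generator_kernel[OF i f smooth_X] by simp
      show ?thesis
      proof (cases "a i \<in> \<Lambda>")
        case True
        then obtain q where "p i = q * [:- a i, 1:]"
          using p(1)[OF i] by (metis dvdE mult.commute)
        moreover have "op_apply [:- a i, 1:] ?g = (\<lambda>x. 0)"
          using linear_power_kernel[OF g True n_pos[OF i] ker] by auto
        ultimately show ?thesis
          using op_apply_mult[OF smooth_X[OF g], of q "[:- a i, 1:]"] by simp
      next
        case False
        then have "\<forall>z\<in>\<Lambda>. poly ([:- a i, 1:] ^ n i) z \<noteq> 0"
          by auto
        then have "?g = (\<lambda>x. 0)"
          using op_injective[of _ ?g] ker g X_subset_adjoin_x by blast
        then show ?thesis
          by simp
      qed
    qed
    then show "act r f x = 0"
      using act_decomposed[OF p(2) f smooth_X] by simp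
  qed
qed

section \<open>Signal spaces between the exponential polynomials and \<open>X[x]\<close>\<close>

context
  fixes F :: "(real \<Rightarrow> complex) set"
  assumes F_subset: "F \<subseteq> adjoin_x X"
    and exp_poly_in_F: "b \<in> \<Lambda> \<Longrightarrow> exp_poly b Q \<in> F"
begin

lemma coprime_multiple_imp_closure:
  assumes "\<forall>z\<in>\<Lambda>. poly L z \<noteq> 0" and "L *s r \<in> M"
  shows "r \<in> willems_closure F M"
  unfolding in_willems_closure_iff
proof (intro ballI allI)
  fix f x assume f: "f \<in> behavior F M"
  then have f_Y: "f $ j \<in> adjoin_x X" for j
    using F_subset by (auto simp: in_behavior_iff)
  then have "op_apply L (act r f) x = 0" for x
    using act_smult[of f L r] smooth_adjoin_x f assms(2) by (metis in_behavior_iff)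
  then show "act r f x = 0"
    using op_injective[OF assms(1) adjoin_x_act[OF f_Y]] by blast
qed

text \<open>Powers of x permit localisation at the full exponent \<open>n i\<close>. At a frequency
  \<open>p i *s e i\<close> then lies in \<open>M\<close>, and the coefficient may be replaced by
  0.\<close>

lemma closure_imp_decomposed:
  assumes r: "r \<in> willems_closure F M"
  shows "\<exists>p. (\<forall>i<k. a i \<in> \<Lambda> \<longrightarrow> p i = 0) \<and> r - (\<Sum>i<k. p i *s e i) \<in> M"
proof -
  obtain c where c: "c \<noteq> 0" "c *s r \<in> M"
    using willems_closure_torsion[OF exp_poly_in_F[OF subsetD[OF Ints_subset]] r] by blast
  then obtain p where p: "r - (\<Sum>i<k. p i *s e i) \<in> M"
    using spanning by blast
  have dvd: "[:- a i, 1:] ^ n i dvd p i" if i: "i < k" "a i \<in> \<Lambda>" for i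
  proof -
    obtain s where "r - [:- a i, 1:] ^ n i *s s \<in> M"
      using willems_closure_localized[of "n i" "a i" F r] r exp_poly_in_F[OF i(2)] n_pos[OF i(1)]
      by blast
    then show ?thesis
      using dvd_coefficient[OF p c _ i(1)] by simp
  qed
  define p' where "p' = (\<lambda>i. if a i \<in> \<Lambda> then 0 else p i)"
  have "(p i - p' i) *s e i \<in> M" if "i < k" for i
  proof (cases "a i \<in> \<Lambda>")
    case True
    from dvd[OF that True] obtain q where "p i = q * [:- a i, 1:] ^ n i"
      by (metis dvdE mult.commute)
    then show ?thesis
      using smult_mem[OF generator[OF that], of q] True by (simp add: p'_def vector_smult_assoc)
  qed (simp add: p'_def zero_mem)
  then have "(r - (\<Sum>i<k. p i *s e i)) + (\<Sum>i<k. (p i - p' i) *s e i) \<in> M"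
    by (intro add_mem p sum_mem) auto
  also have "(r - (\<Sum>i<k. p i *s e i)) + (\<Sum>i<k. (p i - p' i) *s e i) = r - (\<Sum>i<k. p' i *s e i)"
    by (simp add: vec_eq_iff sum_subtractf algebra_simps)
  finally show ?thesis
    by (intro exI[of _ p']) (simp add: p'_def)
qed

lemma decomposed_imp_coprime_multiple:
  assumes "\<forall>i<k. a i \<in> \<Lambda> \<longrightarrow> p i = 0" and "r - (\<Sum>i<k. p i *s e i) \<in> M"
  shows "\<exists>L. (\<forall>z\<in>\<Lambda>. poly L z \<noteq> 0) \<and> L *s r \<in> M"
proof (intro exI conjI ballI)
  let ?I = "{i. i < k \<and> a i \<notin> \<Lambda>}"
  \<comment> \<open>Modulo \<open>M\<close> this kills every summand that can occur with a nonzero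
    coefficient, and its zeros are the \<open>a i\<close> outside \<Lambda>.\<close>
  define L where "L = (\<Prod>i\<in>?I. [:- a i, 1:] ^ n i)"
  show "poly L z \<noteq> 0" if "z \<in> \<Lambda>" for z
    using that by (auto simp: L_def poly_prod)
  have "L *s (p i *s e i) \<in> M" if "i < k" for i
  proof (cases "a i \<in> \<Lambda>")
    case True
    then show ?thesis
      using assms(1) that zero_mem by simp
  next
    case False
    then have "[:- a i, 1:] ^ n i dvd L"
      unfolding L_def using that by (intro dvd_prodI) auto
    then obtain q where q: "L = [:- a i, 1:] ^ n i * q"
      by (rule dvdE)
    have "(p i * q) *s ([:- a i, 1:] ^ n i *s e i) \<in> M"
      using generator[OF that] by (rule smult_mem)
    then show ?thesis
      by (simp add: q vector_smult_assoc mult_ac)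
  qed
  then have "L *s (r - (\<Sum>i<k. p i *s e i)) + (\<Sum>i<k. L *s (p i *s e i)) \<in> M"
    using assms(2) by (intro add_mem[OF smult_mem sum_mem]) auto
  also have "L *s (r - (\<Sum>i<k. p i *s e i)) + (\<Sum>i<k. L *s (p i *s e i)) = L *s r"
    by (simp add: vec_eq_iff algebra_simps sum_distrib_left)
  finally show "L *s r \<in> M" .
qed

text \<open>The last three lemmas form a cycle of implications, which proves this description and
  the next one together.\<close>

lemma in_willems_closure_extended_iff:
  "r \<in> willems_closure F M \<longleftrightarrow>
    (\<exists>p. (\<forall>i<k. a i \<in> \<Lambda> \<longrightarrow> p i = 0) \<and> r - (\<Sum>i<k. p i *s e i) \<in> M)"
  using closure_imp_decomposed decomposed_imp_coprime_multiple coprime_multiple_imp_closure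
  by blast

lemma willems_closure_extended:
  "willems_closure F M = {r. \<exists>L. (\<forall>z\<in>\<Lambda>. poly L z \<noteq> 0) \<and> L *s r \<in> M}"
  using closure_imp_decomposed decomposed_imp_coprime_multiple coprime_multiple_imp_closure
  by blast

end

end

section \<open>Quotients and direct sums\<close>

definition coset :: "'a::ab_group_add set \<Rightarrow> 'a \<Rightarrow> 'a set"
  where "coset H x = (\<lambda>h. h + x) ` H"

lemma a_r_coset_eq_coset: "add G = (+) \<Longrightarrow> H +>\<^bsub>G\<^esub> x = coset H x"
  by (auto simp: a_r_coset_def r_coset_def coset_def)

text \<open>Serves both \<open>DD_mod_power\<close> and the quotient by \<open>M\<close>: the
  carrier is a whole type, so cosets are computed with the addition of that type.\<close>

locale concrete_quotient =
  fixes G :: "('r, 'a::ab_group_add, 'm) module_scheme" and H :: "'a set"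
  assumes carrier_UNIV: "carrier G = UNIV" and add_plus: "add G = (+)"
    and smult_add: "r \<odot>\<^bsub>G\<^esub> (x + y) = r \<odot>\<^bsub>G\<^esub> x + r \<odot>\<^bsub>G\<^esub> y"
    and H_zero: "0 \<in> H" and H_diff: "x \<in> H \<Longrightarrow> y \<in> H \<Longrightarrow> x - y \<in> H"
    and H_smult: "x \<in> H \<Longrightarrow> r \<odot>\<^bsub>G\<^esub> x \<in> H"
begin

lemma H_add: "x \<in> H \<Longrightarrow> y \<in> H \<Longrightarrow> x + y \<in> H"
  using H_diff[of x "0 - y"] H_diff[OF H_zero] by simp

lemma mem_coset_iff: "y \<in> coset H x \<longleftrightarrow> y - x \<in> H"
  by (auto simp: coset_def image_iff) (metis diff_add_cancel)

lemma coset_eq_iff: "coset H x = coset H y \<longleftrightarrow> x - y \<in> H"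
proof
  assume "coset H x = coset H y"
  then show "x - y \<in> H"
    using mem_coset_iff[of x x] mem_coset_iff[of x y] H_zero by simp
next
  assume "x - y \<in> H"
  then have "z - x \<in> H \<longleftrightarrow> z - y \<in> H" for z
    using H_add[of "z - x" "x - y"] H_diff[of "z - y" "x - y"] by auto
  then show "coset H x = coset H y"
    by (auto simp: mem_coset_iff)
qed

lemma coset_0: "coset H 0 = H"
  by (simp add: coset_def)

lemma carrier_quotient: "carrier (quotient_module G H) = range (coset H)"
  by (auto simp: quotient_module_def A_RCOSETS_def' a_r_coset_eq_coset[OF add_plus] carrier_UNIV)

lemma zero_quotient: "\<zero>\<^bsub>quotient_module G H\<^esub> = coset H 0"
  by (simp add: quotient_module_def coset_0)

lemma add_quotient: "coset H x \<oplus>\<^bsub>quotient_module G H\<^esub> coset H y = coset H (x + y)"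
proof -
  have 1: "z - (x + y) \<in> H \<longleftrightarrow> (\<exists>u v. u - x \<in> H \<and> v - y \<in> H \<and> z = u + v)" for z
  proof
    assume z: "z - (x + y) \<in> H"
    have "(z - y) - x \<in> H" "y - y \<in> H" "z = (z - y) + y"
      using z H_zero by (simp_all add: algebra_simps)
    then show "\<exists>u v. u - x \<in> H \<and> v - y \<in> H \<and> z = u + v"
      by blast
  next
    assume "\<exists>u v. u - x \<in> H \<and> v - y \<in> H \<and> z = u + v"
    then show "z - (x + y) \<in> H"
      using H_add by (auto simp: add_diff_add)
  qed
  have 2: "z \<in> coset H x \<oplus>\<^bsub>quotient_module G H\<^esub> coset H y \<longleftrightarrow>
      (\<exists>u v. u \<in> coset H x \<and> v \<in> coset H y \<and> z = u + v)" for z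
    by (auto simp: quotient_module_def set_add_def' add_plus)
  show ?thesis
    by (rule Set.set_eqI) (simp only: 1 2 mem_coset_iff)
qed

text \<open>\<open>quotient_module\<close> takes a union over all representatives; its members
  coincide because \<open>H\<close> is stable under scalars.\<close>

lemma smult_quotient: "r \<odot>\<^bsub>quotient_module G H\<^esub> coset H x = coset H (r \<odot>\<^bsub>G\<^esub> x)"
proof -
  have const: "coset H (r \<odot>\<^bsub>G\<^esub> z) = coset H (r \<odot>\<^bsub>G\<^esub> x)" if "z \<in> coset H x" for z
  proof -
    have "r \<odot>\<^bsub>G\<^esub> z = r \<odot>\<^bsub>G\<^esub> (z - x) + r \<odot>\<^bsub>G\<^esub> x"
      by (simp flip: smult_add)
    moreover have "r \<odot>\<^bsub>G\<^esub> (z - x) \<in> H"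
      using that H_smult by (simp add: mem_coset_iff)
    ultimately show ?thesis
      by (simp add: coset_eq_iff)
  qed
  have "x \<in> coset H x"
    by (simp add: mem_coset_iff H_zero)
  then have "(\<Union>z\<in>coset H x. coset H (r \<odot>\<^bsub>G\<^esub> z)) = coset H (r \<odot>\<^bsub>G\<^esub> x)"
    using UN_least[OF equalityD1[OF const]] UN_upper[of x "coset H x" "\<lambda>z. coset H (r \<odot>\<^bsub>G\<^esub> z)"]
    by (intro equalityI)
  then show ?thesis
    by (simp add: quotient_module_def a_r_coset_eq_coset[OF add_plus])
qed

end

lemma DD_free_simps [simp]:
  "carrier DD_free = UNIV" "zero DD_free = 0" "add DD_free = (+)" "module.smult DD_free = (*s)"
  by (simp_all add: DD_free_def)

lemma DD_self_simps [simp]: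
  "carrier DD_self = UNIV" "zero DD_self = 0" "add DD_self = (+)" "module.smult DD_self = (*)"
  by (simp_all add: DD_self_def)

lemma cgenideal_DD: "PIdl\<^bsub>DD\<^esub> p = {q. p dvd q}"
  by (auto simp: cgenideal_def dvd_def mult.commute)

definition power_coset :: "complex \<Rightarrow> nat \<Rightarrow> complex poly \<Rightarrow> complex poly set"
  where "power_coset a m = coset {q. [:- a, 1:] ^ m dvd q}"

lemma concrete_quotient_power: "concrete_quotient DD_self {q. [:- a, 1:] ^ m dvd q}"
  by unfold_locales (auto simp: algebra_simps)

lemma power_coset_eq_iff: "power_coset a m p = power_coset a m q \<longleftrightarrow> [:- a, 1:] ^ m dvd p - q"
  by (simp add: power_coset_def concrete_quotient.coset_eq_iff[OF concrete_quotient_power])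

lemma DD_mod_power_simps:
  "carrier (DD_mod_power a m) = range (power_coset a m)"
  "\<zero>\<^bsub>DD_mod_power a m\<^esub> = power_coset a m 0"
  "power_coset a m p \<oplus>\<^bsub>DD_mod_power a m\<^esub> power_coset a m q = power_coset a m (p + q)"
  "r \<odot>\<^bsub>DD_mod_power a m\<^esub> power_coset a m p = power_coset a m (r * p)"
  using concrete_quotient.carrier_quotient[OF concrete_quotient_power, of a m]
    concrete_quotient.zero_quotient[OF concrete_quotient_power, of a m]
    concrete_quotient.add_quotient[OF concrete_quotient_power, of a m]
    concrete_quotient.smult_quotient[OF concrete_quotient_power, of a m]
  by (simp_all add: DD_mod_power_def cgenideal_DD power_coset_def)

lemma DD_mod_power_sub_eq: "DD_mod_power_sub a m = power_coset a m ` {p. [:- a, 1:] dvd p}"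
proof -
  have "DD_mod_power_sub a m = range (\<lambda>r. power_coset a m (r * [:- a, 1:]))"
    unfolding DD_mod_power_sub_def cyclic_submodule_def cgenideal_DD
    by (simp only: a_r_coset_eq_coset[OF DD_self_simps(3)] power_coset_def[symmetric]
        DD_mod_power_simps(4) DD_simps(1))
  also have "\<dots> = power_coset a m ` {p. [:- a, 1:] dvd p}"
    by (auto simp: dvd_def image_iff mult.commute)
  finally show ?thesis .
qed

lemma operator_submoduleI:
  assumes "submodule M DD DD_free"
  shows "operator_submodule M"
proof -
  have sub: "subgroup M (add_monoid DD_free)"
    using assms by (rule submodule.axioms(1))
  show ?thesis
  proof
    show "0 \<in> M"
      using subgroup.one_closed[OF sub] by simp
    show "r + s \<in> M" if "r \<in> M" "s \<in> M" for r s
      using subgroup.m_closed[OF sub] that by simp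
    show "p *s r \<in> M" if "r \<in> M" for p r
      using submodule.smult_closed[OF assms, of p r] that by simp
  qed
qed

context operator_submodule
begin

lemma concrete_quotient_M: "concrete_quotient DD_free M"
  by unfold_locales (auto simp: zero_mem diff_mem smult_mem vec.scale_right_distrib vec_eq_iff algebra_simps)

lemmas coset_M_eq_iff = concrete_quotient.coset_eq_iff[OF concrete_quotient_M]
lemmas carrier_quotient_M = concrete_quotient.carrier_quotient[OF concrete_quotient_M]
lemmas zero_quotient_M = concrete_quotient.zero_quotient[OF concrete_quotient_M]
lemmas add_quotient_M = concrete_quotient.add_quotient[OF concrete_quotient_M]
lemmas smult_quotient_M = concrete_quotient.smult_quotient[OF concrete_quotient_M, simplified DD_free_simps]

lemma torsion_quotient:
  "torsion_submodule DD (quotient_module DD_free M) = coset M ` {r. \<exists>p. p \<noteq> 0 \<and> p *s r \<in> M}"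
proof -
  have "(\<exists>p\<in>carrier DD - {\<zero>\<^bsub>DD\<^esub>}. p \<odot>\<^bsub>quotient_module DD_free M\<^esub> coset M r = coset M 0) \<longleftrightarrow>
      (\<exists>p. p \<noteq> 0 \<and> p *s r \<in> M)" for r
    by (simp add: smult_quotient_M coset_M_eq_iff Bex_def)
  moreover have "{x \<in> range (coset M). Q x} = coset M ` {r. Q (coset M r)}" for Q
    by auto
  ultimately show ?thesis
    unfolding torsion_submodule_def carrier_quotient_M zero_quotient_M by simp
qed

lemma closure_quotient_eq: "closure_quotient F M = coset M ` willems_closure F M"
  by (simp add: closure_quotient_def a_r_coset_eq_coset)

end

section \<open>The given isomorphism in coordinates\<close>

locale torsion_isomorphism = operator_submodule M for M :: "(complex poly ^ 'q::finite) set" +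
  fixes k :: nat and a :: "nat \<Rightarrow> complex" and n :: "nat \<Rightarrow> nat"
    and \<phi> :: "(nat \<Rightarrow> complex poly set) \<Rightarrow> (complex poly ^ 'q) set"
  assumes n_ge_1: "\<forall>i<k. n i \<ge> 1"
    and iso: "\<phi> \<in> mod_iso DD (finite_direct_sum {..<k} (\<lambda>i. DD_mod_power (a i) (n i)))
      ((quotient_module DD_free M)
        \<lparr>carrier := torsion_submodule DD (quotient_module DD_free M)\<rparr>)"
begin

text \<open>Elements of the direct sum through polynomial representatives; the restriction makes
  them extensional, as \<open>\<Pi>\<^sub>E\<close> demands.\<close>

definition tuple :: "(nat \<Rightarrow> complex poly) \<Rightarrow> nat \<Rightarrow> complex poly set"
  where "tuple p = (\<lambda>i\<in>{..<k}. power_coset (a i) (n i) (p i))"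

lemma tuple_cong: "(\<And>i. i < k \<Longrightarrow> p i = q i) \<Longrightarrow> tuple p = tuple q"
  by (auto simp: tuple_def intro!: restrict_ext)

lemma tuple_eq_iff: "tuple p = tuple q \<longleftrightarrow> (\<forall>i<k. [:- a i, 1:] ^ n i dvd p i - q i)"
  by (auto simp: tuple_def fun_eq_iff restrict_def power_coset_eq_iff)

text \<open>The products in the theorem all have this shape, with \<open>T i\<close> the polynomials
  allowed in the i-th coordinate.\<close>

lemma PiE_power_coset: "(\<Pi>\<^sub>E i\<in>{..<k}. power_coset (a i) (n i) ` T i) = tuple ` {p. \<forall>i<k. p i \<in> T i}"
proof (intro equalityI subsetI)
  fix u assume u: "u \<in> (\<Pi>\<^sub>E i\<in>{..<k}. power_coset (a i) (n i) ` T i)"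
  then have "\<forall>i. \<exists>p. i < k \<longrightarrow> p \<in> T i \<and> u i = power_coset (a i) (n i) p"
    by (auto simp: PiE_def Pi_def)
  then obtain p where "\<And>i. i < k \<Longrightarrow> p i \<in> T i \<and> u i = power_coset (a i) (n i) (p i)"
    by metis
  moreover from this have "u = tuple p"
    using u by (auto simp: tuple_def fun_eq_iff restrict_def PiE_def extensional_def)
  ultimately show "u \<in> tuple ` {p. \<forall>i<k. p i \<in> T i}"
    by blast
next
  fix u assume "u \<in> tuple ` {p. \<forall>i<k. p i \<in> T i}"
  then show "u \<in> (\<Pi>\<^sub>E i\<in>{..<k}. power_coset (a i) (n i) ` T i)"
    by (auto simp: tuple_def)
qed

lemma carrier_sum: "carrier (finite_direct_sum {..<k} (\<lambda>i. DD_mod_power (a i) (n i))) = range tuple"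
  using PiE_power_coset[of "\<lambda>_. UNIV"] by (simp add: finite_direct_sum_def DD_mod_power_simps)

lemma phi_hom: "\<phi> (tuple p) \<in> coset M ` {r. \<exists>p. p \<noteq> 0 \<and> p *s r \<in> M}"
    "\<phi> (tuple (\<lambda>i. p i + q i)) = \<phi> (tuple p) \<oplus>\<^bsub>quotient_module DD_free M\<^esub> \<phi> (tuple q)"
    "\<phi> (tuple (\<lambda>i. c * p i)) = c \<odot>\<^bsub>quotient_module DD_free M\<^esub> \<phi> (tuple p)"
proof -
  let ?N = "finite_direct_sum {..<k} (\<lambda>i. DD_mod_power (a i) (n i))"
  have hom: "\<phi> \<in> mod_hom DD ?N ((quotient_module DD_free M)
      \<lparr>carrier := torsion_submodule DD (quotient_module DD_free M)\<rparr>)"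
    using iso by (simp add: mod_iso_def)
  have "tuple (\<lambda>i. p i + q i) = tuple p \<oplus>\<^bsub>?N\<^esub> tuple q"
    by (auto simp: finite_direct_sum_def tuple_def fun_eq_iff restrict_def DD_mod_power_simps)
  moreover have "tuple (\<lambda>i. c * p i) = c \<odot>\<^bsub>?N\<^esub> tuple p"
    by (auto simp: finite_direct_sum_def tuple_def fun_eq_iff restrict_def DD_mod_power_simps)
  ultimately show "\<phi> (tuple p) \<in> coset M ` {r. \<exists>p. p \<noteq> 0 \<and> p *s r \<in> M}"
    "\<phi> (tuple (\<lambda>i. p i + q i)) = \<phi> (tuple p) \<oplus>\<^bsub>quotient_module DD_free M\<^esub> \<phi> (tuple q)"
    "\<phi> (tuple (\<lambda>i. c * p i)) = c \<odot>\<^bsub>quotient_module DD_free M\<^esub> \<phi> (tuple p)"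
    using hom by (auto simp: mod_hom_def carrier_sum torsion_quotient Pi_def)
qed

lemma phi_inj: "\<phi> (tuple p) = \<phi> (tuple q) \<Longrightarrow> tuple p = tuple q"
  using iso by (auto simp: mod_iso_def bij_betw_def carrier_sum inj_on_def)

lemma phi_surj: "\<phi> ` range tuple = coset M ` {r. \<exists>p. p \<noteq> 0 \<and> p *s r \<in> M}"
  using iso by (simp add: mod_iso_def bij_betw_def carrier_sum torsion_quotient)

lemma generators_exist:
  "\<exists>e. \<forall>p. \<phi> (tuple p) = coset M (\<Sum>i<k. p i *s e i)"
proof -
  have "\<exists>r. \<phi> (tuple (\<lambda>i. if i = j then 1 else 0)) = coset M r" for j
    using phi_hom(1)[of "\<lambda>i. if i = j then 1 else 0"] by auto
  then obtain e where e: "\<And>j. \<phi> (tuple (\<lambda>i. if i = j then 1 else 0)) = coset M (e j)"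
    by metis
  \<comment> \<open>Unit tuples generate the direct sum; \<open>m\<close> counts the coordinates
    already added.\<close>
  have partial: "\<phi> (tuple (\<lambda>i. if i < m then p i else 0)) = coset M (\<Sum>i<m. p i *s e i)" for p m
  proof (induction m)
    case 0
    \<comment> \<open>\<open>mod_hom\<close> states nothing about zero, so the zero tuple is written
      as 0 times a unit tuple.\<close>
    show ?case
      using phi_hom(3)[of 0 "\<lambda>i. if i = 0 then 1 else 0"] by (simp add: e smult_quotient_M)
  next
    case (Suc m)
    have "tuple (\<lambda>i. if i < Suc m then p i else 0) =
        tuple (\<lambda>i. (if i < m then p i else 0) + p m * (if i = m then 1 else 0))"
      by (rule tuple_cong) (auto simp: less_Suc_eq)
    then show ?case
      by (simp only: phi_hom(2) phi_hom(3) Suc e smult_quotient_M add_quotient_M) simp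
  qed
  have "tuple p = tuple (\<lambda>i. if i < k then p i else 0)" for p
    by (rule tuple_cong) simp
  then show ?thesis
    using partial[of k] by metis
qed

definition e :: "nat \<Rightarrow> complex poly ^ 'q"
  where "e = (SOME e. \<forall>p. \<phi> (tuple p) = coset M (\<Sum>i<k. p i *s e i))"

lemma phi_tuple: "\<phi> (tuple p) = coset M (\<Sum>i<k. p i *s e i)"
  unfolding e_def by (rule someI_ex[OF generators_exist, THEN spec])

lemma sum_in_M_iff: "(\<Sum>i<k. p i *s e i) \<in> M \<longleftrightarrow> (\<forall>i<k. [:- a i, 1:] ^ n i dvd p i)"
proof -
  have "(\<Sum>i<k. p i *s e i) \<in> M \<longleftrightarrow> \<phi> (tuple p) = \<phi> (tuple (\<lambda>i. 0))"
    by (simp add: phi_tuple coset_M_eq_iff)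
  also have "\<dots> \<longleftrightarrow> tuple p = tuple (\<lambda>i. 0)"
    using phi_inj by auto
  finally show ?thesis
    by (simp add: tuple_eq_iff)
qed

sublocale torsion_decomposition M k a n e
proof
  fix i assume "i < k"
  then show "n i \<ge> 1"
    using n_ge_1 by simp
  have "(\<Sum>j<k. (if j = i then [:- a i, 1:] ^ n i else 0) *s e j) \<in> M"
    by (simp add: sum_in_M_iff)
  also have "(\<Sum>j<k. (if j = i then [:- a i, 1:] ^ n i else 0) *s e j) =
      (\<Sum>j<k. if j = i then [:- a i, 1:] ^ n i *s e i else 0)"
    by (rule sum.cong) auto
  finally show "[:- a i, 1:] ^ n i *s e i \<in> M"
    using \<open>i < k\<close> by simp
next
  fix p i assume "(\<Sum>i<k. p i *s e i) \<in> M" "i < k"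
  then show "[:- a i, 1:] ^ n i dvd p i"
    by (simp add: sum_in_M_iff)
next
  fix c r assume "c \<noteq> 0" "c *s r \<in> M"
  then have "coset M r \<in> \<phi> ` range tuple"
    unfolding phi_surj by blast
  then obtain p where "coset M r = \<phi> (tuple p)"
    by blast
  then show "\<exists>p. r - (\<Sum>i<k. p i *s e i) \<in> M"
    by (auto simp: phi_tuple coset_M_eq_iff)
qed

text \<open>By \<open>phi_tuple\<close> the classes of the admissible combinations of the
  \<open>e i\<close> are the images of tuples. Periodic and extended spaces differ only in
  \<open>T\<close>.\<close>

lemma closure_quotient_eq_image:
  assumes "\<And>r. r \<in> willems_closure F M \<longleftrightarrow> (\<exists>p. (\<forall>i<k. p i \<in> T i) \<and> r - (\<Sum>i<k. p i *s e i) \<in> M)"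
  shows "closure_quotient F M = \<phi> ` (\<Pi>\<^sub>E i\<in>{..<k}. power_coset (a i) (n i) ` T i)"
proof -
  have "\<exists>p. (\<forall>i<k. p i \<in> T i) \<and> coset M r = \<phi> (tuple p)" if "r \<in> willems_closure F M" for r
    using that by (simp add: assms phi_tuple coset_M_eq_iff)
  moreover have "(\<Sum>i<k. p i *s e i) \<in> willems_closure F M" if "\<forall>i<k. p i \<in> T i" for p
    unfolding assms using that zero_mem by (intro exI[of _ p]) simp
  ultimately show ?thesis
    unfolding closure_quotient_eq PiE_power_coset image_image by (auto simp: phi_tuple image_iff)
qed

lemma closure_quotient_subset_torsion:
  assumes "\<And>b c. b \<in> \<int> \<Longrightarrow> exp_poly b [:c:] \<in> F"
  shows "closure_quotient F M \<subseteq> torsion_submodule DD (quotient_module DD_free M)"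
  unfolding closure_quotient_eq torsion_quotient
  using willems_closure_torsion[OF assms] by (intro image_mono) auto

end

locale torsion_isomorphism_periods = torsion_isomorphism + period_set
begin

sublocale torsion_decomposition_periods M k a n e P
  by unfold_locales

lemma closure_quotient_periodic:
  "closure_quotient X M = \<phi> ` (\<Pi>\<^sub>E i\<in>{..<k}. if a i \<notin> \<Lambda> then carrier (DD_mod_power (a i) (n i))
      else DD_mod_power_sub (a i) (n i))"
proof -
  let ?T = "\<lambda>i. if a i \<notin> \<Lambda> then UNIV else {p. [:- a i, 1:] dvd p}"
  have "closure_quotient X M = \<phi> ` (\<Pi>\<^sub>E i\<in>{..<k}. power_coset (a i) (n i) ` ?T i)"
  proof (rule closure_quotient_eq_image)
    have "p i \<in> ?T i \<longleftrightarrow> (a i \<in> \<Lambda> \<longrightarrow> [:- a i, 1:] dvd p i)" for p i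
      by simp
    then show "r \<in> willems_closure X M \<longleftrightarrow>
        (\<exists>p. (\<forall>i<k. p i \<in> ?T i) \<and> r - (\<Sum>i<k. p i *s e i) \<in> M)" for r
      by (simp only: in_willems_closure_periodic_iff)
  qed
  also have "(\<lambda>i. power_coset (a i) (n i) ` ?T i) =
      (\<lambda>i. if a i \<notin> \<Lambda> then carrier (DD_mod_power (a i) (n i)) else DD_mod_power_sub (a i) (n i))"
    by (simp add: fun_eq_iff DD_mod_power_simps DD_mod_power_sub_eq)
  finally show ?thesis .
qed

lemma closure_quotient_extended:
  assumes "F \<subseteq> adjoin_x X" and "\<And>b Q. b \<in> \<Lambda> \<Longrightarrow> exp_poly b Q \<in> F"
  shows "closure_quotient F M = \<phi> ` (\<Pi>\<^sub>E i\<in>{..<k}. if a i \<notin> \<Lambda> then carrier (DD_mod_power (a i) (n i))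
      else {\<zero>\<^bsub>DD_mod_power (a i) (n i)\<^esub>})"
proof -
  let ?T = "\<lambda>i. if a i \<notin> \<Lambda> then UNIV else {0}"
  have "closure_quotient F M = \<phi> ` (\<Pi>\<^sub>E i\<in>{..<k}. power_coset (a i) (n i) ` ?T i)"
  proof (rule closure_quotient_eq_image)
    have "p i \<in> ?T i \<longleftrightarrow> (a i \<in> \<Lambda> \<longrightarrow> p i = 0)" for p :: "nat \<Rightarrow> complex poly" and i
      by simp
    then show "r \<in> willems_closure F M \<longleftrightarrow>
        (\<exists>p. (\<forall>i<k. p i \<in> ?T i) \<and> r - (\<Sum>i<k. p i *s e i) \<in> M)" for r
      by (simp only: in_willems_closure_extended_iff[OF assms])
  qed
  also have "(\<lambda>i. power_coset (a i) (n i) ` ?T i) =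
      (\<lambda>i. if a i \<notin> \<Lambda> then carrier (DD_mod_power (a i) (n i)) else {\<zero>\<^bsub>DD_mod_power (a i) (n i)\<^esub>})"
    by (simp add: fun_eq_iff DD_mod_power_simps)
  finally show ?thesis .
qed

end

section \<open>Specialisation to the period 2 pi and to all periods 2 pi N\<close>

context period_set
begin

lemma extended_signal_space:
  assumes "F = adjoin_x X \<or> injective_envelope_in X (adjoin_x X) F \<or> F = explicit_envelope X W"
    and "\<And>w. complex_of_real w \<in> \<Lambda> \<Longrightarrow> w \<in> W"
  shows "F \<subseteq> adjoin_x X" and "b \<in> \<Lambda> \<Longrightarrow> exp_poly b Q \<in> F"
proof -
  show "F \<subseteq> adjoin_x X"
    using assms(1) injective_envelope_subset explicit_envelope_subset by blast
  assume b: "b \<in> \<Lambda>"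
  then obtain w where w: "b = complex_of_real w"
    using frequencies_real by blast
  show "exp_poly b Q \<in> F"
    using assms(1)
  proof (elim disjE)
    assume "F = explicit_envelope X W"
    then show ?thesis
      using exp_poly_in_explicit_envelope assms(2) b by (simp add: w)
  qed (use b exp_poly_in_adjoin_x exp_poly_in_injective_envelope in blast)+
qed

end

interpretation period_T: period_set "{1}"
  by unfold_locales auto

interpretation period_PT: period_set "{1..}"
  by unfold_locales auto

lemma spaces_TD:
  assumes "F \<in> spaces_T"
  shows "F \<subseteq> adjoin_x C_T" and "b \<in> \<int> \<Longrightarrow> exp_poly b Q \<in> F"
proof -
  have "w \<in> \<int>" if "complex_of_real w \<in> frequencies {1}" for w
    using that by (simp only: frequencies_1 of_real_in_Ints_iff)
  then show "F \<subseteq> adjoin_x C_T" "b \<in> \<int> \<Longrightarrow> exp_poly b Q \<in> F"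
    using assms period_T.extended_signal_space[of F \<int>] unfolding spaces_T_def C_T_eq frequencies_1
    by blast+
qed

lemma spaces_PTD:
  assumes "F \<in> spaces_PT"
  shows "F \<subseteq> adjoin_x C_PT" and "b \<in> \<rat> \<Longrightarrow> exp_poly b Q \<in> F"
proof -
  have "w \<in> \<rat>" if "complex_of_real w \<in> frequencies {1..}" for w
    using that by (simp only: frequencies_ge_1 Rats_complex_of_real_iff)
  then show "F \<subseteq> adjoin_x C_PT" "b \<in> \<rat> \<Longrightarrow> exp_poly b Q \<in> F"
    using assms period_PT.extended_signal_space[of F \<rat>] unfolding spaces_PT_def C_PT_eq frequencies_ge_1
    by blast+
qed

text \<open>With the decomposition given as an isomorphism \<phi>, the formulas are equalities of
  subsets of the quotient by \<open>M\<close>, not mere isomorphisms.\<close>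

theorem mainTheorem6:
  fixes M :: "(complex poly ^ 'q::finite) set"
    and k :: nat and a :: "nat \<Rightarrow> complex" and n :: "nat \<Rightarrow> nat"
    and \<phi> :: "(nat \<Rightarrow> complex poly set) \<Rightarrow> (complex poly ^ 'q) set"
  assumes "submodule M DD DD_free"
    and "\<forall>i<k. n i \<ge> 1"
    and "\<phi> \<in> mod_iso DD (finite_direct_sum {..<k} (\<lambda>i. DD_mod_power (a i) (n i)))
      ((quotient_module DD_free M)
        \<lparr>carrier := torsion_submodule DD (quotient_module DD_free M)\<rparr>)"
  shows
    "(\<forall>F \<in> {C_T, C_PT} \<union> spaces_T \<union> spaces_PT.
        closure_quotient F M \<subseteq> torsion_submodule DD (quotient_module DD_free M)) \<and>
     closure_quotient C_T M =
        \<phi> ` (\<Pi>\<^sub>E i\<in>{..<k}. if a i \<notin> \<int> then carrier (DD_mod_power (a i) (n i))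
                                   else DD_mod_power_sub (a i) (n i)) \<and>
     (\<forall>F \<in> spaces_T.
        closure_quotient F M =
          \<phi> ` (\<Pi>\<^sub>E i\<in>{..<k}. if a i \<notin> \<int> then carrier (DD_mod_power (a i) (n i))
                                     else {\<zero>\<^bsub>DD_mod_power (a i) (n i)\<^esub>}) \<and>
        willems_closure F M = {r. \<exists>L. (\<forall>z\<in>\<int>. poly L z \<noteq> 0) \<and> L *s r \<in> M}) \<and>
     closure_quotient C_PT M =
        \<phi> ` (\<Pi>\<^sub>E i\<in>{..<k}. if a i \<notin> \<rat> then carrier (DD_mod_power (a i) (n i))
                                   else DD_mod_power_sub (a i) (n i)) \<and>
     (\<forall>F \<in> spaces_PT.
        closure_quotient F M =
          \<phi> ` (\<Pi>\<^sub>E i\<in>{..<k}. if a i \<notin> \<rat> then carrier (DD_mod_power (a i) (n i))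
                                     else {\<zero>\<^bsub>DD_mod_power (a i) (n i)\<^esub>}) \<and>
        willems_closure F M = {r. \<exists>L. (\<forall>z\<in>\<rat>. poly L z \<noteq> 0) \<and> L *s r \<in> M})"
proof -
  interpret operator_submodule M
    using assms(1) by (rule operator_submoduleI)
  interpret torsion_isomorphism M k a n \<phi>
    using assms(2,3) by unfold_locales
  interpret T: torsion_isomorphism_periods M k a n \<phi> "{1}"
    by unfold_locales
  interpret PT: torsion_isomorphism_periods M k a n \<phi> "{1..}"
    by unfold_locales
  \<comment> \<open>The torsion bound rests on exponentials of integral frequency, and these lie in
    every space considered, integers being rational.\<close>
  have "exp_poly b [:c:] \<in> F"
    if F: "F \<in> {C_T, C_PT} \<union> spaces_T \<union> spaces_PT" and b: "b \<in> \<int>" for F b c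
  proof -
    have "b \<in> \<rat>"
      using b Ints_subset_Rats by blast
    then show ?thesis
      using F b period_T.exp_in_X[of b c] period_PT.exp_in_X[of b c] spaces_TD(2) spaces_PTD(2)
      unfolding C_T_eq C_PT_eq frequencies_1 frequencies_ge_1 by blast
  qed
  note torsion = closure_quotient_subset_torsion[OF this]
  show ?thesis
    by (intro conjI ballI torsion
        T.closure_quotient_periodic[unfolded frequencies_1, folded C_T_eq]
        PT.closure_quotient_periodic[unfolded frequencies_ge_1, folded C_PT_eq]
        T.closure_quotient_extended[unfolded frequencies_1, folded C_T_eq]
        PT.closure_quotient_extended[unfolded frequencies_ge_1, folded C_PT_eq]
        T.willems_closure_extended[unfolded frequencies_1, folded C_T_eq]
        PT.willems_closure_extended[unfolded frequencies_ge_1, folded C_PT_eq]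
        spaces_TD spaces_PTD)
qed

end
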